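(* Let $\mathbb{k}$ be a field, $S=\mathbb{k}[x_1,\ldots,x_n]$, and let $I\subseteq S$ be the ideal generated by all square-free monomials of degree three. For an integer $k\ge1$ let $\beta_i^{(k)}=\beta_i(S/I^k)$. Then $$\beta_1^{(k)}=\binom{n+3k-1}{n-1}-n\binom{n+2k-2}{n-1}+\binom{n}{2}\binom{n+k-3}{n-1},$$ $$\beta_n^{(k)}=\binom{n+3k-2}{n-1}-n\binom{n+2k-2}{n-1}+\binom{n}{2}\binom{n+k-2}{n-1},$$ and $$\begin{bmatrix}\beta_2^{(k)}\\ \vdots\\ \beta_{n-1}^{(k)}\end{bmatrix}=\left[\binom{j}{i}\right]_{\substack{0\le i\le n-3\\ 0\le j\le n-3}}\left[\beta_1^{(k)}-(-1)^{n+i}\beta_n^{(k)}\binom{n-2}{i}-\binom{3k+i}{i}\right]_{0\le i\le n-3}.$$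
   Context: For a homogeneous ideal $J\subset S$ (standard grading), the Betti numbers $\beta_i(S/J)$ are the ranks of the free modules in a minimal graded free resolution $0\to S^{\beta_n}\to\cdots\to S^{\beta_1}\to S\to S/J\to 0$. Convention: $\binom{j}{i}=0$ when $i>j$. $[c_{ij}]$ denotes the matrix with entry $c_{ij}$ in row $i$, column $j$, and $[c_i]$ denotes a column vector. *)

theory Defs
  imports "HOL-Library.Poly_Mapping" "HOL-Library.Cardinality" "Jordan_Normal_Form.Matrix_Kernel"
begin

section \<open>The polynomial ring\<close>

text \<open>
  The ring \<open>S = k[x\<^sub>1, \<dots>, x\<^sub>n]\<close> is the type \<open>('v, 'k) mpoly\<close> of finitely supported functions from
  exponent vectors to coefficients. The variables are the elements of the finite index type \<open>'v\<close>,
  so \<open>n = CARD('v)\<close>.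
\<close>

type_synonym 'v mon = "'v \<Rightarrow>\<^sub>0 nat"
type_synonym ('v, 'k) mpoly = "'v mon \<Rightarrow>\<^sub>0 'k"

definition mon_degree :: "'v mon \<Rightarrow> nat" where
  "mon_degree m = (\<Sum>v\<in>Poly_Mapping.keys m. Poly_Mapping.lookup m v)"

definition squarefree_mon :: "'v mon \<Rightarrow> bool" where
  "squarefree_mon m \<longleftrightarrow> (\<forall>v. Poly_Mapping.lookup m v \<le> 1)"

definition monomial :: "'v mon \<Rightarrow> ('v, 'k::comm_ring_1) mpoly" where
  "monomial m = Poly_Mapping.single m 1"

definition Var :: "'v \<Rightarrow> ('v, 'k::comm_ring_1) mpoly" where
  "Var v = monomial (Poly_Mapping.single v 1)"

text \<open>
  The zero polynomial is homogeneous of every degree, and it is the only homogeneous polynomial of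
  a negative degree.
\<close>

definition homogeneous :: "int \<Rightarrow> ('v, 'k::comm_ring_1) mpoly \<Rightarrow> bool" where
  "homogeneous e f \<longleftrightarrow> (\<forall>m\<in>Poly_Mapping.keys f. int (mon_degree m) = e)"

section \<open>Ideals\<close>

text \<open>An ideal is a submodule of the ring regarded as a module over itself.\<close>

interpretation ring_as_module: Modules.module "(*) :: 'a::comm_ring_1 \<Rightarrow> 'a \<Rightarrow> 'a"
  by unfold_locales (simp_all add: algebra_simps)

definition ideal_generated :: "'a::comm_ring_1 set \<Rightarrow> 'a set" where
  "ideal_generated G = ring_as_module.span G"

primrec ideal_power :: "'a::comm_ring_1 set \<Rightarrow> nat \<Rightarrow> 'a set" where
  "ideal_power I 0 = UNIV"
| "ideal_power I (Suc k) = ideal_generated {a * b | a b. a \<in> I \<and> b \<in> ideal_power I k}"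

definition irrelevant_ideal :: "('v, 'k::comm_ring_1) mpoly set" where
  "irrelevant_ideal = ideal_generated (range Var)"

section \<open>Minimal graded free resolutions and Betti numbers\<close>

definition mat_image :: "'a::comm_ring_1 mat \<Rightarrow> 'a vec set" where
  "mat_image A = (\<lambda>v. A *\<^sub>v v) ` carrier_vec (dim_col A)"

text \<open>
  A minimal graded free resolution \<open>0 \<rightarrow> F\<^sub>n \<rightarrow> \<dots> \<rightarrow> F\<^sub>1 \<rightarrow> F\<^sub>0 = S \<rightarrow> S/J \<rightarrow> 0\<close> of \<open>S/J\<close>, for a proper
  homogeneous ideal \<open>J\<close>. The list \<open>F i\<close> consists of the degrees of the homogeneous basis elements
  of the graded free module \<open>F\<^sub>i\<close>, so a list \<open>[a, b, \<dots>]\<close> stands for \<open>S(-a) \<oplus> S(-b) \<oplus> \<dots>\<close> and the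
  rank of \<open>F\<^sub>i\<close> is \<open>length (F i)\<close>. The matrix \<open>d (Suc i)\<close> is the differential with source \<open>F (Suc i)\<close>
  and target \<open>F i\<close>; the value \<open>d 0\<close> is irrelevant. The condition on \<open>mat_image (d 1)\<close> says that the
  cokernel of the first differential is \<open>S/J\<close>; the last condition is minimality: each differential
  maps its source into the irrelevant ideal times its target.
\<close>

definition minimal_graded_free_resolution ::
  "('v::finite, 'k::field) mpoly set \<Rightarrow> (nat \<Rightarrow> int list) \<Rightarrow> (nat \<Rightarrow> ('v, 'k) mpoly mat) \<Rightarrow> bool"
where
  "minimal_graded_free_resolution J F d \<longleftrightarrow>
     F 0 = [0] \<and>
     (\<forall>i > CARD('v). F i = []) \<and>
     (\<forall>i. d (Suc i) \<in> carrier_mat (length (F i)) (length (F (Suc i)))) \<and>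
     (\<forall>i. \<forall>p < length (F i). \<forall>q < length (F (Suc i)).
        homogeneous (F (Suc i) ! q - F i ! p) (d (Suc i) $$ (p, q))) \<and>
     mat_image (d 1) = {v \<in> carrier_vec 1. v $ 0 \<in> J} \<and>
     (\<forall>i \<ge> 1. mat_kernel (d i) = mat_image (d (Suc i))) \<and>
     (\<forall>i. \<forall>p < length (F i). \<forall>q < length (F (Suc i)). d (Suc i) $$ (p, q) \<in> irrelevant_ideal)"

definition betti :: "('v::finite, 'k::field) mpoly set \<Rightarrow> nat \<Rightarrow> nat" where
  "betti J i = (THE r. \<exists>F d. minimal_graded_free_resolution J F d \<and> length (F i) = r)"

end

theory Submission
  imports Defs
begin

text \<open>
  The power \<open>I\<^sup>k\<close> is generated by all monomials of degree \<open>3k\<close> with exponents at most \<open>k\<close>. Added in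
  decreasing lexicographic order, these generators have linear quotients: the colon ideal of the
  earlier generators by \<open>u\<close> is generated by the variables that can be exchanged against a later
  variable of \<open>u\<close>. Iterated mapping cones over Koszul complexes therefore produce a linear, hence
  minimal, free resolution, in which \<open>u\<close> contributes \<open>binomial c (i - 1)\<close> to the \<open>i\<close>-th rank, where
  \<open>c\<close> is the number of these variables. Ranks of minimal resolutions are unique because
  comparison maps become mutually inverse modulo the irrelevant ideal. Counting the generators with
  \<open>c = j\<close> gives \<open>binomial (3k - 1 + j) j\<close> for \<open>j < n - 2\<close>; the two remaining numbers, for \<open>j = n - 2\<close> and
  \<open>j = n - 1\<close>, are determined by the first and the last Betti number.
\<close>

section \<open>Homogeneous polynomials and monomial ideals\<close>

text \<open>The delicate point is minimality of the cones. Projectivity supplies comparison maps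
  without any control over their entries, and a constant entry would spoil minimality. Here every
  generator has degree \<open>3k\<close> and every colon ideal is generated in degree 1, so once a
  comparison map is replaced by its homogeneous component of the right degree, all its entries have
  positive degree. Minimality is then automatic. The counts rest on two different mechanisms. The
  first and last Betti numbers count all sequences under a bound on the entries, and
  inclusion-exclusion stops at pairs because the sum is less than three times the strict bound. The
  counts for small \<open>j\<close> do not involve \<open>n\<close> at all: between two free
  positions a sequence can only repeat the maximal exponent \<open>k\<close>, so each stretch is a
  number written by division with remainder by \<open>k\<close>.\<close>

lemma mon_degree_eq_sum:
  fixes m :: "'v::finite mon"
  shows "mon_degree m = (\<Sum>v\<in>UNIV. Poly_Mapping.lookup m v)"
  unfolding mon_degree_def by (rule sum.mono_neutral_left) (auto simp: in_keys_iff)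

lemma mon_degree_add:
  fixes m :: "'v::finite mon"
  shows "mon_degree (m + m') = mon_degree m + mon_degree m'"
  by (simp add: mon_degree_eq_sum lookup_add sum.distrib)

lemma mon_degree_single [simp]: "mon_degree (Poly_Mapping.single v a) = a"
  by (simp add: mon_degree_def)

lemma homogeneous_mult:
  fixes f g :: "('v::finite, 'k::comm_ring_1) mpoly"
  assumes "homogeneous a f" "homogeneous b g"
  shows "homogeneous (a + b) (f * g)"
  using assms keys_mult[of f g] unfolding homogeneous_def by (fastforce simp: mon_degree_add)

lemma homogeneous_0 [simp]: "homogeneous a 0"
  by (simp add: homogeneous_def)

lemma homogeneous_uminus: "homogeneous a f \<Longrightarrow> homogeneous a (- f)"
  by (simp add: homogeneous_def in_keys_iff)

lemma homogeneous_monomial: "homogeneous (int (mon_degree m)) (monomial m)"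
  by (simp add: homogeneous_def monomial_def)

definition hom_part :: "nat \<Rightarrow> ('v, 'k::comm_ring_1) mpoly \<Rightarrow> ('v, 'k) mpoly" where
  "hom_part a f = (\<Sum>m | m \<in> Poly_Mapping.keys f \<and> mon_degree m = a.
     Poly_Mapping.single m (Poly_Mapping.lookup f m))"

lemma lookup_hom_part:
  "Poly_Mapping.lookup (hom_part a f) m = (if mon_degree m = a then Poly_Mapping.lookup f m else 0)"
proof -
  have "Poly_Mapping.lookup (hom_part a f) m =
     (\<Sum>x | x \<in> Poly_Mapping.keys f \<and> mon_degree x = a. if x = m then Poly_Mapping.lookup f m else 0)"
    unfolding hom_part_def lookup_sum
    by (intro sum.cong refl) (auto simp: lookup_single when_def)
  then show ?thesis by (auto simp: in_keys_iff)
qed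

lemma keys_hom_part: "Poly_Mapping.keys (hom_part a f) = {m \<in> Poly_Mapping.keys f. mon_degree m = a}"
  by (auto simp: in_keys_iff lookup_hom_part split: if_splits)

lemma hom_part_add: "hom_part a (f + g) = hom_part a f + hom_part a g"
  by (rule poly_mapping_eqI) (simp add: lookup_hom_part lookup_add)

lemma hom_part_0 [simp]: "hom_part a 0 = 0"
  by (rule poly_mapping_eqI) (simp add: lookup_hom_part)

lemma hom_part_sum: "hom_part a (sum f A) = (\<Sum>x\<in>A. hom_part a (f x))"
  by (induction A rule: infinite_finite_induct) (auto simp: hom_part_add)

lemma homogeneous_hom_part: "homogeneous (int a) (hom_part a f)"
  by (simp add: homogeneous_def keys_hom_part)

lemma hom_part_homogeneous: "homogeneous (int a) f \<Longrightarrow> hom_part a f = f"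
  by (rule poly_mapping_eqI) (auto simp: lookup_hom_part homogeneous_def in_keys_iff)

text \<open>The product of \<open>f\<close> with the rest \<open>g - hom_part b g\<close> has no
  term of degree \<open>a + b\<close>. This commutation later allows comparison maps to be made
  homogeneous.\<close>

lemma hom_part_mult:
  fixes f g :: "('v::finite, 'k::comm_ring_1) mpoly"
  assumes "homogeneous (int a) f"
  shows "hom_part (a + b) (f * g) = f * hom_part b g"
proof -
  have split: "f * g = f * hom_part b g + f * (g - hom_part b g)"
    by (simp add: algebra_simps)
  have "mon_degree m \<noteq> a + b" if m: "m \<in> Poly_Mapping.keys (f * (g - hom_part b g))" for m
  proof -
    obtain p q where "p \<in> Poly_Mapping.keys f" "q \<in> Poly_Mapping.keys (g - hom_part b g)" "m = p + q"
      using m keys_mult[of f "g - hom_part b g"] by blast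
    then show ?thesis using assms
      by (auto simp: mon_degree_add homogeneous_def in_keys_iff lookup_minus lookup_hom_part split: if_splits)
  qed
  then have "hom_part (a + b) (f * (g - hom_part b g)) = 0"
    by (intro poly_mapping_eqI) (auto simp: lookup_hom_part in_keys_iff)
  moreover have "hom_part (a + b) (f * hom_part b g) = f * hom_part b g"
    using homogeneous_mult[OF assms homogeneous_hom_part[of b g]] by (intro hom_part_homogeneous) simp
  ultimately show ?thesis by (subst split) (simp add: hom_part_add)
qed

section \<open>Monomial ideals and the irrelevant ideal\<close>

definition mon_dvd :: "'v mon \<Rightarrow> 'v mon \<Rightarrow> bool" where
  "mon_dvd a m \<longleftrightarrow> (\<forall>v. Poly_Mapping.lookup a v \<le> Poly_Mapping.lookup m v)"

lemma mon_dvd_iff: "mon_dvd a m \<longleftrightarrow> (\<exists>c. m = a + c)"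
proof
  assume "mon_dvd a m"
  then have "m = a + (m - a)"
    by (intro poly_mapping_eqI) (simp add: lookup_add lookup_minus mon_dvd_def)
  then show "\<exists>c. m = a + c" ..
qed (auto simp: mon_dvd_def lookup_add)

text \<open>Membership is decided on the support, so that colons and products of ideals become
  statements about exponent vectors; \<open>ideal_generated_monomials\<close> identifies this set
  with the generated ideal.\<close>

definition mon_ideal :: "'v mon set \<Rightarrow> ('v, 'k::comm_ring_1) mpoly set" where
  "mon_ideal G = {f. \<forall>m\<in>Poly_Mapping.keys f. \<exists>a\<in>G. mon_dvd a m}"

lemma poly_mapping_sum_single: "f = (\<Sum>m\<in>Poly_Mapping.keys f. Poly_Mapping.single m (Poly_Mapping.lookup f m))"
proof (rule poly_mapping_eqI)
  fix m
  have "(\<Sum>x\<in>Poly_Mapping.keys f. Poly_Mapping.lookup (Poly_Mapping.single x (Poly_Mapping.lookup f x)) m) =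
     (\<Sum>x\<in>Poly_Mapping.keys f. if x = m then Poly_Mapping.lookup f m else 0)"
    by (intro sum.cong refl) (auto simp: lookup_single when_def)
  then show "Poly_Mapping.lookup f m = Poly_Mapping.lookup (\<Sum>m\<in>Poly_Mapping.keys f. Poly_Mapping.single m (Poly_Mapping.lookup f m)) m"
    by (auto simp: lookup_sum in_keys_iff)
qed

lemma mon_ideal_add: "f \<in> mon_ideal G \<Longrightarrow> g \<in> mon_ideal G \<Longrightarrow> f + g \<in> mon_ideal G"
  using keys_add[of f g] unfolding mon_ideal_def by blast

lemma mon_ideal_mult: "g \<in> mon_ideal G \<Longrightarrow> f * g \<in> mon_ideal G"
proof -
  assume g: "g \<in> mon_ideal G"
  have "\<exists>a\<in>G. mon_dvd a m" if m: "m \<in> Poly_Mapping.keys (f * g)" for m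
  proof -
    obtain p q where "q \<in> Poly_Mapping.keys g" "m = p + q"
      using m keys_mult[of f g] by blast
    moreover then obtain a c where "a \<in> G" "q = a + c"
      using g by (auto simp: mon_ideal_def mon_dvd_iff)
    ultimately show ?thesis by (auto simp: mon_dvd_iff intro!: bexI[of _ a] exI[of _ "p + c"] simp: ac_simps)
  qed
  then show ?thesis by (simp add: mon_ideal_def)
qed

lemma ideal_generated_monomials: "ideal_generated (monomial ` G) = mon_ideal G"
proof (rule equalityI; rule subsetI)
  fix f :: "('a, 'b) mpoly"
  assume "f \<in> ideal_generated (monomial ` G)"
  then show "f \<in> mon_ideal G"
    unfolding ideal_generated_def
  proof (induction f rule: ring_as_module.span_induct_alt)
    case base
    then show ?case by (simp add: mon_ideal_def)
  next
    case (step c x y)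
    then have "x \<in> mon_ideal G"
      by (auto simp: mon_ideal_def monomial_def mon_dvd_def)
    then show ?case using step by (auto intro: mon_ideal_add mon_ideal_mult)
  qed
next
  fix f :: "('a, 'b) mpoly"
  assume f: "f \<in> mon_ideal G"
  have "Poly_Mapping.single m (Poly_Mapping.lookup f m) \<in> ring_as_module.span (monomial ` G)"
    if "m \<in> Poly_Mapping.keys f" for m
  proof -
    obtain a c where "a \<in> G" "m = a + c"
      using f \<open>m \<in> _\<close> by (auto simp: mon_ideal_def mon_dvd_iff)
    then have "Poly_Mapping.single m (Poly_Mapping.lookup f m) = Poly_Mapping.single c (Poly_Mapping.lookup f m) * monomial a"
      by (simp add: monomial_def mult_single ac_simps)
    then show ?thesis using \<open>a \<in> G\<close>
      by (simp add: ring_as_module.span_base ring_as_module.span_scale)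
  qed
  then show "f \<in> ideal_generated (monomial ` G)"
    unfolding ideal_generated_def
    by (subst poly_mapping_sum_single) (rule ring_as_module.span_sum)
qed

lemma lookup_mult_monomial:
  "Poly_Mapping.lookup (f * monomial u) (m + u) = Poly_Mapping.lookup f m"
proof -
  have "f * monomial u = (\<Sum>x\<in>Poly_Mapping.keys f. Poly_Mapping.single (x + u) (Poly_Mapping.lookup f x))"
    by (subst (1) poly_mapping_sum_single) (simp add: sum_distrib_right monomial_def mult_single)
  then have "Poly_Mapping.lookup (f * monomial u) (m + u) =
      (\<Sum>x\<in>Poly_Mapping.keys f. if x = m then Poly_Mapping.lookup f m else 0)"
    by (auto simp: lookup_sum lookup_single when_def intro!: sum.cong)
  then show ?thesis by (auto simp: in_keys_iff)
qed

lemma keys_mult_monomial: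
  "Poly_Mapping.keys (f * monomial u) = (\<lambda>m. m + u) ` Poly_Mapping.keys f"
proof
  show "Poly_Mapping.keys (f * monomial u) \<subseteq> (\<lambda>m. m + u) ` Poly_Mapping.keys f"
    using keys_mult[of f "monomial u"] by (auto simp: monomial_def split: if_splits)
  show "(\<lambda>m. m + u) ` Poly_Mapping.keys f \<subseteq> Poly_Mapping.keys (f * monomial u)"
    by (auto simp: in_keys_iff lookup_mult_monomial)
qed

text \<open>Multiplication by a monomial translates the support without cancellation, so a colon by
  \<open>u\<close> can be read off from exponents.\<close>

lemma mon_ideal_colon:
  fixes f :: "('v, 'k::comm_ring_1) mpoly"
  assumes "\<And>m. (\<exists>a\<in>G. mon_dvd a (m + u)) \<longleftrightarrow> (\<exists>a\<in>H. mon_dvd a m)"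
  shows "f * monomial u \<in> mon_ideal G \<longleftrightarrow> f \<in> mon_ideal H"
  by (simp add: mon_ideal_def keys_mult_monomial assms)

lemma mon_ideal_insert:
  fixes f :: "('v, 'k::comm_ring_1) mpoly"
  shows "f \<in> mon_ideal (insert u G) \<longleftrightarrow> (\<exists>g h. g \<in> mon_ideal G \<and> f = g + h * monomial u)"
  unfolding ideal_generated_monomials[symmetric] ideal_generated_def image_insert
    ring_as_module.span_insert
proof (intro iffI CollectI; (elim CollectE exE conjE)?)
  fix k assume "f - k * monomial u \<in> ring_as_module.span (monomial ` G)"
  then show "\<exists>g h. g \<in> ring_as_module.span (monomial ` G) \<and> f = g + h * monomial u"
    by (intro exI[of _ "f - k * monomial u"] exI[of _ k]) simp
next
  fix g h assume "g \<in> ring_as_module.span (monomial ` G)" "f = g + h * monomial u"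
  then show "\<exists>k. f - k * monomial u \<in> ring_as_module.span (monomial ` G)"
    by (intro exI[of _ h]) simp
qed

lemma mon_ideal_empty [simp]: "mon_ideal {} = {0}"
  by (auto simp: mon_ideal_def)

text \<open>Turns minimality of a differential into the vanishing of its constant
  coefficients.\<close>

lemma irrelevant_ideal_iff:
  fixes f :: "('v, 'k::comm_ring_1) mpoly"
  shows "f \<in> irrelevant_ideal \<longleftrightarrow> Poly_Mapping.lookup f 0 = 0"
proof -
  have eq: "irrelevant_ideal = (mon_ideal (range (\<lambda>v. Poly_Mapping.single v 1)) :: ('v, 'k) mpoly set)"
    unfolding irrelevant_ideal_def ideal_generated_monomials[symmetric] image_image Var_def ..
  have ex: "(\<exists>a\<in>range (\<lambda>v. Poly_Mapping.single v (1::nat)). mon_dvd a m) \<longleftrightarrow> m \<noteq> 0" for m :: "'v mon"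
  proof -
    have "mon_dvd (Poly_Mapping.single v 1) m \<longleftrightarrow> Poly_Mapping.lookup m v \<noteq> 0" for v
      by (auto simp: mon_dvd_def lookup_single when_def)
    then show ?thesis by (auto simp: poly_mapping_eq_iff fun_eq_iff)
  qed
  have "f \<in> irrelevant_ideal \<longleftrightarrow> (\<forall>m\<in>Poly_Mapping.keys f. m \<noteq> 0)"
    unfolding eq mon_ideal_def mem_Collect_eq ex ..
  then show ?thesis by (metis in_keys_iff)
qed

text \<open>The constant coefficient is the quotient map by the irrelevant ideal: replacing each
  factor by its constant term changes the product only by elements of that ideal.\<close>

lemma lookup_mult_0:
  fixes f g :: "('v, 'k::comm_ring_1) mpoly"
  shows "Poly_Mapping.lookup (f * g) 0 = Poly_Mapping.lookup f 0 * Poly_Mapping.lookup g 0"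
proof -
  let ?c = "\<lambda>f :: ('v, 'k) mpoly. (Poly_Mapping.single 0 (Poly_Mapping.lookup f 0) :: ('v, 'k) mpoly)"
  have irr: "Poly_Mapping.lookup (h * (q - ?c q)) 0 = 0" for h q :: "('v, 'k) mpoly"
  proof -
    have "q - ?c q \<in> irrelevant_ideal"
      by (simp add: irrelevant_ideal_iff lookup_minus)
    then have "h * (q - ?c q) \<in> irrelevant_ideal"
      unfolding irrelevant_ideal_def ideal_generated_def by (rule ring_as_module.span_scale)
    then show ?thesis by (simp only: irrelevant_ideal_iff)
  qed
  have "a * b = a * (b - d) + (d * (a - c) + c * d)" for a b c d :: "('v, 'k) mpoly"
    by (simp add: algebra_simps)
  then have "Poly_Mapping.lookup (f * g) 0 =
      Poly_Mapping.lookup (f * (g - ?c g) + (?c g * (f - ?c f) + ?c f * ?c g)) 0" by simp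
  also have "\<dots> = Poly_Mapping.lookup (?c f * ?c g) 0"
    by (simp only: lookup_add irr add_0)
  finally have "Poly_Mapping.lookup (f * g) 0 = Poly_Mapping.lookup (?c f * ?c g) 0" .
  then show ?thesis by (simp add: mult_single)
qed

lemma homogeneous_imp_irrelevant: "homogeneous a f \<Longrightarrow> 0 < a \<Longrightarrow> f \<in> irrelevant_ideal"
  by (rule ccontr) (auto simp: irrelevant_ideal_iff homogeneous_def mon_degree_def not_in_keys_iff_lookup_eq_zero[symmetric])

section \<open>Free resolutions and uniqueness of minimal ranks\<close>

text \<open>Ranks are an explicit function, and degrees are recorded separately by
  \<open>hom_mat\<close>, so that comparison maps, homotopies and cones are matrix algebra over a
  commutative ring.\<close>

definition free_resolution :: "'a::comm_ring_1 set \<Rightarrow> (nat \<Rightarrow> nat) \<Rightarrow> (nat \<Rightarrow> 'a mat) \<Rightarrow> bool" where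
  "free_resolution J r d \<longleftrightarrow> r 0 = 1 \<and> (\<forall>i. d (Suc i) \<in> carrier_mat (r i) (r (Suc i))) \<and>
     mat_image (d 1) = {v \<in> carrier_vec 1. v $ 0 \<in> J} \<and>
     (\<forall>i. mat_kernel (d (Suc i)) = mat_image (d (Suc (Suc i))))"

lemma
  assumes "free_resolution J r d"
  shows resolution_rank_0: "r 0 = 1"
    and resolution_carrier: "d (Suc i) \<in> carrier_mat (r i) (r (Suc i))"
    and resolution_image: "mat_image (d (Suc 0)) = {v \<in> carrier_vec 1. v $ 0 \<in> J}"
    and resolution_exact: "mat_kernel (d (Suc i)) = mat_image (d (Suc (Suc i)))"
  using assms unfolding free_resolution_def by auto

lemma mat_imageI: "A \<in> carrier_mat nr nc \<Longrightarrow> v \<in> carrier_vec nc \<Longrightarrow> A *\<^sub>v v \<in> mat_image A"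
  by (auto simp: mat_image_def)

lemma mat_imageE:
  assumes "w \<in> mat_image A" "A \<in> carrier_mat nr nc"
  obtains v where "v \<in> carrier_vec nc" "w = A *\<^sub>v v"
  using assms by (auto simp: mat_image_def)

lemma mult_unit_vec_col:
  fixes A :: "'a::comm_ring_1 mat"
  assumes "A \<in> carrier_mat nr nc" "j < nc"
  shows "A *\<^sub>v unit_vec nc j = col A j"
  using assms by (intro eq_vecI) auto

lemma mat_eqI_vec:
  fixes A B :: "'a::comm_ring_1 mat"
  assumes "A \<in> carrier_mat nr nc" "B \<in> carrier_mat nr nc"
    and "\<And>v. v \<in> carrier_vec nc \<Longrightarrow> A *\<^sub>v v = B *\<^sub>v v"
  shows "A = B"
proof (rule mat_col_eqI)
  fix j assume "j < dim_col B"
  then show "col A j = col B j"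
    using assms(3)[of "unit_vec nc j"] assms(1,2) mult_unit_vec_col
    by (metis carrier_matD(2) unit_vec_carrier)
qed (use assms in auto)

lemma zero_mat_mult_vec: "v \<in> carrier_vec nc \<Longrightarrow> 0\<^sub>m nr nc *\<^sub>v v = 0\<^sub>v nr"
  by (intro eq_vecI) auto

lemma minus_minus_mat:
  fixes A B :: "'a::ab_group_add mat"
  assumes "A \<in> carrier_mat nr nc" "B \<in> carrier_mat nr nc"
  shows "A - (A - B) = B"
  using assms by (intro eq_matI) auto

text \<open>Projectivity of free modules in matrix form: each column of \<open>B\<close> is lifted
  through \<open>A\<close> separately.\<close>

lemma mat_factor:
  assumes A: "A \<in> carrier_mat nr n" and B: "B \<in> carrier_mat nr nc"
    and image: "\<And>v. v \<in> carrier_vec nc \<Longrightarrow> B *\<^sub>v v \<in> mat_image A"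
  obtains X where "X \<in> carrier_mat n nc" "B = A * X"
proof -
  have "\<exists>w \<in> carrier_vec n. col B j = A *\<^sub>v w" if "j < nc" for j
  proof -
    have "col B j \<in> mat_image A"
      using image[of "unit_vec nc j"] B that by (simp add: mult_unit_vec_col)
    then show ?thesis using A by (auto elim: mat_imageE)
  qed
  then obtain w where w: "\<And>j. j < nc \<Longrightarrow> w j \<in> carrier_vec n \<and> col B j = A *\<^sub>v w j" by metis
  define X where "X = mat_of_cols n (map w [0..<nc])"
  have X: "X \<in> carrier_mat n nc" by (intro carrier_matI) (simp_all add: X_def)
  have "B = A * X"
  proof (rule mat_col_eqI)
    fix j assume "j < dim_col (A * X)"
    then have j: "j < nc" using X by simp
    then have "col X j = w j" using w[of j] by (simp add: X_def)
    then show "col B j = col (A * X) j" using w[OF j] col_mult2[OF A X j] by metis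
  qed (use A B X in auto)
  with X show ?thesis by (rule that)
qed

lemma resolution_complex:
  assumes "free_resolution J r d"
  shows "d (Suc i) * d (Suc (Suc i)) = 0\<^sub>m (r i) (r (Suc (Suc i)))"
proof (rule mat_eqI_vec)
  fix v :: "'a vec" assume v: "v \<in> carrier_vec (r (Suc (Suc i)))"
  have "d (Suc (Suc i)) *\<^sub>v v \<in> mat_kernel (d (Suc i))"
    unfolding resolution_exact[OF assms]
    by (rule mat_imageI[OF resolution_carrier[OF assms] v])
  then have "d (Suc i) *\<^sub>v (d (Suc (Suc i)) *\<^sub>v v) = 0\<^sub>v (r i)"
    using mat_kernelD(2)[OF resolution_carrier[OF assms]] by blast
  then show "(d (Suc i) * d (Suc (Suc i))) *\<^sub>v v = 0\<^sub>m (r i) (r (Suc (Suc i))) *\<^sub>v v"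
    using resolution_carrier[OF assms, of i] resolution_carrier[OF assms, of "Suc i"] v
    by (simp add: zero_mat_mult_vec)
qed (use resolution_carrier[OF assms, of i] resolution_carrier[OF assms, of "Suc i"] in auto)

lemma resolution_factor:
  assumes "free_resolution J r d" and M: "M \<in> carrier_mat (r (Suc i)) c"
    and "d (Suc i) * M = 0\<^sub>m (r i) c"
  obtains X where "X \<in> carrier_mat (r (Suc (Suc i))) c" "M = d (Suc (Suc i)) * X"
proof (rule mat_factor[OF resolution_carrier[OF assms(1)] M])
  fix v :: "'a vec" assume v: "v \<in> carrier_vec c"
  have "d (Suc i) *\<^sub>v (M *\<^sub>v v) = (d (Suc i) * M) *\<^sub>v v"
    using resolution_carrier[OF assms(1), of i] M v by simp
  then show "M *\<^sub>v v \<in> mat_image (d (Suc (Suc i)))"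
    unfolding resolution_exact[OF assms(1), symmetric] assms(3)
    using resolution_carrier[OF assms(1), of i] M v
    by (intro mat_kernelI[where nr = "r i" and nc = "r (Suc i)"]) (auto simp: zero_mat_mult_vec)
qed (use that in blast)

text \<open>The comparison theorem: the modules of \<open>e\<close> are free and \<open>d\<close> is
  exact, so \<open>\<phi>0\<close> lifts degree by degree.\<close>

lemma chain_map_exists:
  assumes res: "free_resolution J r d"
    and e: "\<And>i. e (Suc i) \<in> carrier_mat (s i) (s (Suc i))"
      "\<And>i. e (Suc i) * e (Suc (Suc i)) = 0\<^sub>m (s i) (s (Suc (Suc i)))"
    and \<phi>0: "\<phi>0 \<in> carrier_mat (r 0) (s 0)"
      "\<And>v. v \<in> carrier_vec (s 1) \<Longrightarrow> \<phi>0 *\<^sub>v (e 1 *\<^sub>v v) \<in> mat_image (d 1)"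
  obtains \<phi> where "\<phi> 0 = \<phi>0" "\<And>i. \<phi> i \<in> carrier_mat (r i) (s i)"
    "\<And>i. d (Suc i) * \<phi> (Suc i) = \<phi> i * e (Suc i)"
proof -
  note d = resolution_carrier[OF res]
  \<comment> \<open>Besides the shape of \<open>X\<close>, the predicate demands that the next
    square can be filled; the filling \<open>Y\<close> becomes the matrix chosen in the next
    degree.\<close>
  let ?P = "\<lambda>i X. X \<in> carrier_mat (r i) (s i) \<and> (i = 0 \<longrightarrow> X = \<phi>0) \<and>
    (\<exists>Y \<in> carrier_mat (r (Suc i)) (s (Suc i)). X * e (Suc i) = d (Suc i) * Y)"
  have d1: "d 1 \<in> carrier_mat (r 0) (r 1)" and e1: "e 1 \<in> carrier_mat (s 0) (s 1)"
    using d[of 0] e(1)[of 0] by simp_all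
  obtain Y where "Y \<in> carrier_mat (r 1) (s 1)" "\<phi>0 * e 1 = d 1 * Y"
  proof (rule mat_factor[OF d1 mult_carrier_mat[OF \<phi>0(1) e1]])
    fix v :: "'a vec" assume v: "v \<in> carrier_vec (s 1)"
    then show "(\<phi>0 * e 1) *\<^sub>v v \<in> mat_image (d 1)"
      unfolding assoc_mult_mat_vec[OF \<phi>0(1) e1 v] by (rule \<phi>0(2))
  qed
  then have "\<exists>X. ?P 0 X" using \<phi>0 by auto
  moreover have "\<exists>Y. ?P (Suc i) Y \<and> d (Suc i) * Y = X * e (Suc i)" if P: "?P i X" for i X
  proof -
    from P obtain Y where X: "X \<in> carrier_mat (r i) (s i)"
      and Y: "Y \<in> carrier_mat (r (Suc i)) (s (Suc i))" "X * e (Suc i) = d (Suc i) * Y" by auto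
    have "d (Suc i) * (Y * e (Suc (Suc i))) = (d (Suc i) * Y) * e (Suc (Suc i))"
      by (rule assoc_mult_mat[symmetric, OF d Y(1) e(1)])
    also have "\<dots> = X * (e (Suc i) * e (Suc (Suc i)))"
      unfolding Y(2)[symmetric] by (rule assoc_mult_mat[OF X e(1) e(1)])
    also have "\<dots> = 0\<^sub>m (r i) (s (Suc (Suc i)))"
      unfolding e(2) by (rule right_mult_zero_mat[OF X])
    finally obtain Z where "Z \<in> carrier_mat (r (Suc (Suc i))) (s (Suc (Suc i)))"
      "Y * e (Suc (Suc i)) = d (Suc (Suc i)) * Z"
      by (rule resolution_factor[OF res mult_carrier_mat[OF Y(1) e(1)]])
    then show ?thesis using Y by (intro exI[of _ Y]) auto
  qed
  ultimately have "\<exists>\<phi>. \<forall>i. ?P i (\<phi> i) \<and> d (Suc i) * \<phi> (Suc i) = \<phi> i * e (Suc i)"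
    by (rule dependent_nat_choice)
  then show ?thesis using that by blast
qed

text \<open>The homotopy between \<open>\<theta>\<close> and the identity is built one degree at a time.\<close>

lemma chain_endomorphism_homotopy:
  assumes res: "free_resolution J r d"
    and \<theta>: "\<And>i. \<theta> i \<in> carrier_mat (r i) (r i)"
      "\<And>i. d (Suc i) * \<theta> (Suc i) = \<theta> i * d (Suc i)"
      "\<theta> 0 = 1\<^sub>m (r 0)"
  shows "\<exists>g \<in> carrier_mat (r (Suc i)) (r i). \<exists>h \<in> carrier_mat (r (Suc (Suc i))) (r (Suc i)).
    \<theta> (Suc i) = 1\<^sub>m (r (Suc i)) + (g * d (Suc i) + d (Suc (Suc i)) * h)"
proof -
  note d = resolution_carrier[OF res]
  \<comment> \<open>The first conjunct says that the defect left in degree \<open>i\<close> vanishes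
    on the image of \<open>d (Suc i)\<close>. It puts the defect in degree \<open>Suc i\<close> into
    the kernel of \<open>d (Suc i)\<close>, and exactness yields \<open>h\<close>, which serves as
    \<open>g\<close> in the next step.\<close>
  have "\<exists>g \<in> carrier_mat (r (Suc i)) (r i). (\<theta> i - 1\<^sub>m (r i) - d (Suc i) * g) * d (Suc i) = 0\<^sub>m (r i) (r (Suc i))
     \<and> (\<exists>h \<in> carrier_mat (r (Suc (Suc i))) (r (Suc i)).
    \<theta> (Suc i) - 1\<^sub>m (r (Suc i)) - g * d (Suc i) = d (Suc (Suc i)) * h)" for i
  proof -
    have step: "\<exists>h \<in> carrier_mat (r (Suc (Suc i))) (r (Suc i)).
        \<theta> (Suc i) - 1\<^sub>m (r (Suc i)) - g * d (Suc i) = d (Suc (Suc i)) * h"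
      if g: "g \<in> carrier_mat (r (Suc i)) (r i)"
        and eq: "(\<theta> i - 1\<^sub>m (r i) - d (Suc i) * g) * d (Suc i) = 0\<^sub>m (r i) (r (Suc i))" for i g
    proof -
      let ?M = "\<theta> (Suc i) - 1\<^sub>m (r (Suc i)) - g * d (Suc i)"
      have gd: "g * d (Suc i) \<in> carrier_mat (r (Suc i)) (r (Suc i))" "d (Suc i) * g \<in> carrier_mat (r i) (r i)"
        using g d[of i] by auto
      have M: "?M \<in> carrier_mat (r (Suc i)) (r (Suc i))"
        by (rule minus_carrier_mat[OF gd(1)])
      have m1: "\<theta> (Suc i) - 1\<^sub>m (r (Suc i)) \<in> carrier_mat (r (Suc i)) (r (Suc i))"
        "\<theta> i - 1\<^sub>m (r i) \<in> carrier_mat (r i) (r i)"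
        by (rule minus_carrier_mat[OF one_carrier_mat])+
      have "d (Suc i) * ?M = d (Suc i) * \<theta> (Suc i) - d (Suc i) * 1\<^sub>m (r (Suc i)) - d (Suc i) * (g * d (Suc i))"
        by (simp only: mult_minus_distrib_mat[OF d m1(1) gd(1)]
            mult_minus_distrib_mat[OF d \<theta>(1) one_carrier_mat])
      also have "\<dots> = \<theta> i * d (Suc i) - 1\<^sub>m (r i) * d (Suc i) - (d (Suc i) * g) * d (Suc i)"
        using d[of i] g by (simp add: \<theta>(2))
      also have "\<dots> = (\<theta> i - 1\<^sub>m (r i) - d (Suc i) * g) * d (Suc i)"
        by (simp only: minus_mult_distrib_mat[OF m1(2) gd(2) d]
            minus_mult_distrib_mat[OF \<theta>(1) one_carrier_mat d])
      finally have "d (Suc i) * ?M = 0\<^sub>m (r i) (r (Suc i))" unfolding eq .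
      then show ?thesis by (rule resolution_factor[OF res M]) blast
    qed
    show ?thesis
    proof (induction i)
      case 0
      \<comment> \<open>As \<open>\<theta> 0\<close> is the identity, there is no defect in degree 0
        and the homotopy starts with zero.\<close>
      let ?g = "0\<^sub>m (r (Suc 0)) (r 0) :: 'a mat"
      have 0: "(\<theta> 0 - 1\<^sub>m (r 0) - d (Suc 0) * ?g) * d (Suc 0) = 0\<^sub>m (r 0) (r (Suc 0))"
      proof -
        have "1\<^sub>m (r 0) - 1\<^sub>m (r 0) - d (Suc 0) * ?g = 0\<^sub>m (r 0) (r 0)"
          using d[of 0] by (intro eq_matI) auto
        then show ?thesis unfolding \<theta>(3) using left_mult_zero_mat[OF d] by simp
      qed
      show ?case by (rule bexI[of _ ?g], rule conjI[OF 0 step[OF _ 0]]) auto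
    next
      case (Suc i)
      then obtain g h where g: "g \<in> carrier_mat (r (Suc i)) (r i)"
        and h: "h \<in> carrier_mat (r (Suc (Suc i))) (r (Suc i))"
        and eq: "\<theta> (Suc i) - 1\<^sub>m (r (Suc i)) - g * d (Suc i) = d (Suc (Suc i)) * h" by blast
      let ?T = "\<theta> (Suc i) - 1\<^sub>m (r (Suc i))"
      have gd: "g * d (Suc i) \<in> carrier_mat (r (Suc i)) (r (Suc i))"
        and T: "?T \<in> carrier_mat (r (Suc i)) (r (Suc i))"
        by (rule mult_carrier_mat[OF g d], rule minus_carrier_mat[OF one_carrier_mat])
      have "?T - d (Suc (Suc i)) * h = g * d (Suc i)"
        unfolding eq[symmetric] by (rule minus_minus_mat[OF T gd])
      then have "(?T - d (Suc (Suc i)) * h) * d (Suc (Suc i)) = g * (d (Suc i) * d (Suc (Suc i)))"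
        by (simp add: assoc_mult_mat[OF g d d])
      also have "\<dots> = 0\<^sub>m (r (Suc i)) (r (Suc (Suc i)))"
        unfolding resolution_complex[OF res] by (rule right_mult_zero_mat[OF g])
      finally have 1: "(?T - d (Suc (Suc i)) * h) * d (Suc (Suc i)) = 0\<^sub>m (r (Suc i)) (r (Suc (Suc i)))" .
      show ?case by (rule bexI[of _ h], rule conjI[OF 1 step[OF h 1]]) (rule h)
    qed
  qed
  then obtain g h where g: "g \<in> carrier_mat (r (Suc i)) (r i)"
    and h: "h \<in> carrier_mat (r (Suc (Suc i))) (r (Suc i))"
    and eq: "\<theta> (Suc i) - 1\<^sub>m (r (Suc i)) - g * d (Suc i) = d (Suc (Suc i)) * h" by blast
  have gd: "g * d (Suc i) \<in> carrier_mat (r (Suc i)) (r (Suc i))" by (rule mult_carrier_mat[OF g d])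
  have "B = C + (G + (B - C - G))" if "B \<in> carrier_mat m m" "C \<in> carrier_mat m m" "G \<in> carrier_mat m m"
    for B C G :: "'a mat" and m
    using that by (intro eq_matI) auto
  from this[OF \<theta>(1) one_carrier_mat gd] have "\<theta> (Suc i) = 1\<^sub>m (r (Suc i)) + (g * d (Suc i) + d (Suc (Suc i)) * h)"
    unfolding eq .
  then show ?thesis using g h by blast
qed

section \<open>Reduction modulo the irrelevant ideal and comparison of ranks\<close>

lemma left_inverse_mat_dim_le:
  fixes A B :: "'a::field mat"
  assumes A: "A \<in> carrier_mat s r" and B: "B \<in> carrier_mat r s" and BA: "B * A = 1\<^sub>m r"
  shows "r \<le> s"
proof (rule ccontr)
  assume "\<not> r \<le> s"
  then have sr: "s < r" by simp
  \<comment> \<open>Padding both factors with zeros to size \<open>r\<close> keeps the product equal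
    to the identity, but row \<open>s\<close> of the padded \<open>A\<close> is zero, so its
    determinant vanishes.\<close>
  let ?A = "mat r r (\<lambda>(i, j). if i < s then A $$ (i, j) else 0)"
  let ?B = "mat r r (\<lambda>(i, j). if j < s then B $$ (i, j) else 0)"
  have "?B * ?A = 1\<^sub>m r"
  proof (rule eq_matI)
    fix i j assume "i < dim_row (1\<^sub>m r :: 'a mat)" "j < dim_col (1\<^sub>m r :: 'a mat)"
    then have ij: "i < r" "j < r" by auto
    have "(?B * ?A) $$ (i, j) = (\<Sum>k = 0..<r. if k < s then B $$ (i, k) * A $$ (k, j) else 0)"
      using ij by (auto simp: scalar_prod_def intro!: sum.cong)
    also have "\<dots> = (\<Sum>k = 0..<s. B $$ (i, k) * A $$ (k, j))"
      using sr by (intro sum.mono_neutral_cong_right) auto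
    also have "\<dots> = (B * A) $$ (i, j)"
      using ij A B by (auto simp: scalar_prod_def)
    finally show "(?B * ?A) $$ (i, j) = 1\<^sub>m r $$ (i, j)" unfolding BA .
  qed auto
  moreover have cA: "?A \<in> carrier_mat r r" and cB: "?B \<in> carrier_mat r r" by auto
  ultimately have "det ?B * det ?A = 1" using det_mult[OF cB cA] by simp
  moreover have "det ?A = 0"
  proof -
    have "?A = mat\<^sub>r r r (\<lambda>i. if i = s then 0\<^sub>v r else row ?A i)"
      using A sr by (intro eq_matI) auto
    then show ?thesis using det_row_0[of s r "row ?A"] sr cA by fastforce
  qed
  ultimately show False by simp
qed

text \<open>This is the base change of a matrix to the residue field of the irrelevant
  ideal.\<close>

definition const_coeffs :: "('v, 'k::comm_ring_1) mpoly mat \<Rightarrow> 'k mat" where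
  "const_coeffs = map_mat (\<lambda>f. Poly_Mapping.lookup f 0)"

lemma const_coeffs_carrier [simp]: "A \<in> carrier_mat nr nc \<Longrightarrow> const_coeffs A \<in> carrier_mat nr nc"
  by (simp add: const_coeffs_def)

lemma const_coeffs_mult:
  "A \<in> carrier_mat nr n \<Longrightarrow> B \<in> carrier_mat n nc \<Longrightarrow> const_coeffs (A * B) = const_coeffs A * const_coeffs B"
  by (intro eq_matI) (auto simp: const_coeffs_def scalar_prod_def lookup_sum lookup_mult_0)

lemma const_coeffs_add:
  "A \<in> carrier_mat nr nc \<Longrightarrow> B \<in> carrier_mat nr nc \<Longrightarrow> const_coeffs (A + B) = const_coeffs A + const_coeffs B"
  by (intro eq_matI) (auto simp: const_coeffs_def lookup_add)

lemma const_coeffs_one: "const_coeffs (1\<^sub>m n) = 1\<^sub>m n"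
  by (intro eq_matI) (auto simp: const_coeffs_def)

definition minimal_mats :: "(nat \<Rightarrow> nat) \<Rightarrow> (nat \<Rightarrow> ('v, 'k::comm_ring_1) mpoly mat) \<Rightarrow> bool" where
  "minimal_mats r d \<longleftrightarrow> (\<forall>i. \<forall>p < r i. \<forall>q < r (Suc i). d (Suc i) $$ (p, q) \<in> irrelevant_ideal)"

text \<open>The composite of the two comparison maps is homotopic to the identity of the minimal
  resolution. Each term of the homotopy contains a differential of that resolution, hence dies in
  the residue field, and the reduced \<open>\<phi> i\<close> acquires a left inverse over a
  field.\<close>

lemma minimal_resolution_rank_le:
  fixes d e :: "nat \<Rightarrow> ('v, 'k::field) mpoly mat"
  assumes r: "free_resolution J r d" and s: "free_resolution J s e" and min: "minimal_mats r d"
  shows "r i \<le> s i"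
proof -
  note d = resolution_carrier[OF r] and e = resolution_carrier[OF s]
  have rs: "r 0 = 1" "s 0 = 1" using r s by (simp_all add: resolution_rank_0)
  have im: "mat_image (d 1) = mat_image (e 1)"
    using resolution_image[OF r] resolution_image[OF s] by simp
  have im': "d 1 *\<^sub>v v \<in> mat_image (e 1)" if "v \<in> carrier_vec (r 1)" for v
    using that d[of 0] unfolding im[symmetric] by (auto intro: mat_imageI)
  have im'': "e 1 *\<^sub>v v \<in> mat_image (d 1)" if "v \<in> carrier_vec (s 1)" for v
    using that e[of 0] unfolding im by (auto intro: mat_imageI)
  obtain \<phi> where \<phi>: "\<phi> 0 = 1\<^sub>m 1" "\<And>i. \<phi> i \<in> carrier_mat (s i) (r i)"
      "\<And>i. e (Suc i) * \<phi> (Suc i) = \<phi> i * d (Suc i)"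
  proof (rule chain_map_exists[OF s, of d r "1\<^sub>m 1"])
    show "\<And>i. d (Suc i) * d (Suc (Suc i)) = 0\<^sub>m (r i) (r (Suc (Suc i)))"
      by (rule resolution_complex[OF r])
    show "1\<^sub>m 1 *\<^sub>v (d 1 *\<^sub>v v) \<in> mat_image (e 1)" if "v \<in> carrier_vec (r 1)" for v
    proof -
      have "d 1 *\<^sub>v v \<in> carrier_vec 1" using d[of 0] that rs by auto
      then show ?thesis using im'[OF that] by simp
    qed
  qed (use d rs in auto)
  obtain \<psi> where \<psi>: "\<psi> 0 = 1\<^sub>m 1" "\<And>i. \<psi> i \<in> carrier_mat (r i) (s i)"
      "\<And>i. d (Suc i) * \<psi> (Suc i) = \<psi> i * e (Suc i)"
  proof (rule chain_map_exists[OF r, of e s "1\<^sub>m 1"])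
    show "\<And>i. e (Suc i) * e (Suc (Suc i)) = 0\<^sub>m (s i) (s (Suc (Suc i)))"
      by (rule resolution_complex[OF s])
    show "1\<^sub>m 1 *\<^sub>v (e 1 *\<^sub>v v) \<in> mat_image (d 1)" if "v \<in> carrier_vec (s 1)" for v
    proof -
      have "e 1 *\<^sub>v v \<in> carrier_vec 1" using e[of 0] that rs by auto
      then show ?thesis using im''[OF that] by simp
    qed
  qed (use e rs in auto)
  have chain: "d (Suc i) * (\<psi> (Suc i) * \<phi> (Suc i)) = (\<psi> i * \<phi> i) * d (Suc i)" for i
    unfolding assoc_mult_mat[OF d \<psi>(2) \<phi>(2), symmetric] \<psi>(3) assoc_mult_mat[OF \<psi>(2) e \<phi>(2)]
      \<phi>(3) assoc_mult_mat[OF \<psi>(2) \<phi>(2) d] ..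
  have "const_coeffs (\<psi> i * \<phi> i) = 1\<^sub>m (r i)"
  proof (cases i)
    case 0
    then show ?thesis using \<phi>(1) \<psi>(1) rs by (simp add: const_coeffs_one)
  next
    case (Suc j)
    have zero: "const_coeffs (d (Suc i)) = 0\<^sub>m (r i) (r (Suc i))" for i
      using min d[of i] by (intro eq_matI) (auto simp: minimal_mats_def const_coeffs_def irrelevant_ideal_iff)
    have "\<psi> 0 * \<phi> 0 = 1\<^sub>m (r 0)" using \<phi>(1) \<psi>(1) rs by simp
    then obtain g h where g: "g \<in> carrier_mat (r (Suc j)) (r j)"
      and h: "h \<in> carrier_mat (r (Suc (Suc j))) (r (Suc j))"
      and eq: "\<psi> (Suc j) * \<phi> (Suc j) = 1\<^sub>m (r (Suc j)) + (g * d (Suc j) + d (Suc (Suc j)) * h)"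
      using chain_endomorphism_homotopy[OF r, of "\<lambda>i. \<psi> i * \<phi> i" j, OF mult_carrier_mat[OF \<psi>(2) \<phi>(2)] chain]
      by blast
    have gd: "g * d (Suc j) \<in> carrier_mat (r (Suc j)) (r (Suc j))"
        "d (Suc (Suc j)) * h \<in> carrier_mat (r (Suc j)) (r (Suc j))"
      by (rule mult_carrier_mat[OF g d], rule mult_carrier_mat[OF d h])
    have "const_coeffs (\<psi> (Suc j) * \<phi> (Suc j)) =
        1\<^sub>m (r (Suc j)) + (const_coeffs g * const_coeffs (d (Suc j)) + const_coeffs (d (Suc (Suc j))) * const_coeffs h)"
      unfolding eq const_coeffs_add[OF one_carrier_mat add_carrier_mat[OF gd(2)]]
        const_coeffs_add[OF gd] const_coeffs_mult[OF g d] const_coeffs_mult[OF d h] const_coeffs_one ..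
    also have "\<dots> = 1\<^sub>m (r (Suc j))"
      unfolding zero using const_coeffs_carrier[OF g] const_coeffs_carrier[OF h] by simp
    finally show ?thesis using Suc by simp
  qed
  then have "const_coeffs (\<psi> i) * const_coeffs (\<phi> i) = 1\<^sub>m (r i)"
    by (simp add: const_coeffs_mult[OF \<psi>(2) \<phi>(2)])
  then show ?thesis
    by (rule left_inverse_mat_dim_le[OF const_coeffs_carrier[OF \<phi>(2)] const_coeffs_carrier[OF \<psi>(2)]])
qed

section \<open>Mapping cones and linear resolutions\<close>

lemma uminus_uminus_vec: "- (- v) = (v :: 'a::group_add vec)"
  by (intro eq_vecI) auto

lemma add_vec_eq_0_imp_uminus:
  fixes x y :: "'a::ab_group_add vec"
  assumes "x \<in> carrier_vec n" "y \<in> carrier_vec n" "x + y = 0\<^sub>v n"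
  shows "y = - x"
proof (rule eq_vecI)
  fix i assume "i < dim_vec (- x)"
  then have i: "i < n" using assms(1) by simp
  then have "x $ i + y $ i = 0" using arg_cong[OF assms(3), of "\<lambda>v. v $ i"] assms(1,2) by simp
  then show "y $ i = (- x) $ i" using assms(1) i by (simp add: add_eq_0_iff)
qed (use assms in auto)

text \<open>Since \<open>L\<close> is the colon of \<open>J\<close> by \<open>u\<close>,
  multiplication by \<open>u\<close> embeds \<open>S/L\<close> into \<open>S/J\<close> with cokernel
  the quotient by \<open>J + (u)\<close>. The chain map \<open>\<phi>\<close> lifts this embedding
  and \<open>c\<close> is its cone: \<open>t\<close> shifts the ranks of the second resolution by
  one, the sign in \<open>\<delta>\<close> makes consecutive differentials cancel, and
  \<open>\<delta> 0\<close> has no rows because the second summand is absent in degree 0.\<close>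

lemma mapping_cone:
  fixes d e :: "nat \<Rightarrow> 'a::comm_ring_1 mat"
  assumes r: "free_resolution J r d" and s: "free_resolution L s e"
    and colon: "\<And>f. f \<in> L \<longleftrightarrow> f * u \<in> J"
    and \<phi>: "\<And>i. \<phi> i \<in> carrier_mat (r i) (s i)" "\<phi> 0 = mat 1 1 (\<lambda>_. u)"
      "\<And>i. d (Suc i) * \<phi> (Suc i) = \<phi> i * e (Suc i)"
  defines "t \<equiv> \<lambda>i. if i = 0 then 0 else s (i - 1)"
    and "\<delta> \<equiv> \<lambda>i. if i = 0 then 0\<^sub>m 0 1 else - e i"
  defines "c \<equiv> \<lambda>i. four_block_mat (d i) (\<phi> (i - 1)) (0\<^sub>m (t (i - 1)) (r i)) (\<delta> (i - 1))"
  shows "free_resolution {g + h * u | g h. g \<in> J} (\<lambda>i. r i + t i) c"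
proof -
  note d = resolution_carrier[OF r] and e = resolution_carrier[OF s]
  have rs: "r 0 = 1" "s 0 = 1" using r s by (simp_all add: resolution_rank_0)
  have t: "t 0 = 0" "t (Suc i) = s i" for i by (simp_all add: t_def)
  have \<delta>: "\<delta> i \<in> carrier_mat (t i) (s i)" for i
  proof (cases i)
    case (Suc j)
    then show ?thesis using e[of j] by (simp add: \<delta>_def t)
  qed (simp add: \<delta>_def t rs)
  have c: "c (Suc i) \<in> carrier_mat (r i + t i) (r (Suc i) + s i)" for i
    unfolding c_def using four_block_carrier_mat[OF d \<delta>] by simp
  have c_mult: "c (Suc i) *\<^sub>v (a @\<^sub>v b) = (d (Suc i) *\<^sub>v a + \<phi> i *\<^sub>v b) @\<^sub>v (\<delta> i *\<^sub>v b)"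
    if "a \<in> carrier_vec (r (Suc i))" "b \<in> carrier_vec (s i)" for i a b
  proof -
    have "c (Suc i) *\<^sub>v (a @\<^sub>v b) =
        (d (Suc i) *\<^sub>v a + \<phi> i *\<^sub>v b) @\<^sub>v (0\<^sub>m (t i) (r (Suc i)) *\<^sub>v a + \<delta> i *\<^sub>v b)"
      unfolding c_def diff_Suc_1
      by (rule four_block_mat_mult_vec[OF d \<phi>(1) zero_carrier_mat \<delta> that])
    also have "0\<^sub>m (t i) (r (Suc i)) *\<^sub>v a + \<delta> i *\<^sub>v b = \<delta> i *\<^sub>v b"
      unfolding zero_mat_mult_vec[OF that(1)]
      by (rule left_zero_vec[OF mult_mat_vec_carrier[OF \<delta> that(2)]])
    finally show ?thesis .
  qed
  have \<phi>0: "\<phi> 0 *\<^sub>v b = vec 1 (\<lambda>_. u * b $ 0)" if "b \<in> carrier_vec 1" for b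
    using that unfolding \<phi>(2) by (intro eq_vecI) (auto simp: scalar_prod_def)
  have image: "mat_image (c 1) = {v \<in> carrier_vec 1. v $ 0 \<in> {g + h * u | g h. g \<in> J}}"
  proof (intro equalityI subsetI)
    fix v assume "v \<in> mat_image (c 1)"
    then obtain w where w: "w \<in> carrier_vec (r 1 + s 0)" "v = c 1 *\<^sub>v w"
      using c[of 0] by (auto elim: mat_imageE)
    define a b where "a = vec_first w (r 1)" and "b = vec_last w (s 0)"
    have ab: "a \<in> carrier_vec (r 1)" "b \<in> carrier_vec (s 0)" "w = a @\<^sub>v b"
      using vec_first_last_append[OF w(1)] by (auto simp: a_def b_def)
    have da: "d 1 *\<^sub>v a \<in> carrier_vec 1" "(d 1 *\<^sub>v a) $ 0 \<in> J"
      using mat_imageI[OF d, of a 0] ab(1) resolution_image[OF r] by auto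
    have b: "b \<in> carrier_vec 1" using ab rs by simp
    have "v = (d 1 *\<^sub>v a + \<phi> 0 *\<^sub>v b) @\<^sub>v (\<delta> 0 *\<^sub>v b)"
      using c_mult[of a 0 b] ab w(2) by simp
    also have "\<delta> 0 *\<^sub>v b = 0\<^sub>v 0" by (intro eq_vecI) (auto simp: \<delta>_def)
    finally have v: "v = (d 1 *\<^sub>v a + \<phi> 0 *\<^sub>v b) @\<^sub>v 0\<^sub>v 0" .
    then have "v $ 0 = (d 1 *\<^sub>v a) $ 0 + b $ 0 * u" "v \<in> carrier_vec 1"
      unfolding v \<phi>0[OF b] using da by (auto simp: mult.commute intro!: carrier_vecI)
    then show "v \<in> {v \<in> carrier_vec 1. v $ 0 \<in> {g + h * u | g h. g \<in> J}}"
      using da by auto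
  next
    fix v assume "v \<in> {v \<in> carrier_vec 1. v $ 0 \<in> {g + h * u | g h. g \<in> J}}"
    then obtain g h where v: "v \<in> carrier_vec 1" "v $ 0 = g + h * u" "g \<in> J" by auto
    have "vec 1 (\<lambda>_. g) \<in> mat_image (d 1)" using resolution_image[OF r] v(3) by simp
    then obtain a where a: "a \<in> carrier_vec (r 1)" "vec 1 (\<lambda>_. g) = d 1 *\<^sub>v a"
      using d[of 0] by (auto elim: mat_imageE)
    let ?b = "vec 1 (\<lambda>_. h)"
    have b: "?b \<in> carrier_vec (s 0)" "?b \<in> carrier_vec 1" using rs by simp_all
    have "c 1 *\<^sub>v (a @\<^sub>v ?b) = (vec 1 (\<lambda>_. g) + \<phi> 0 *\<^sub>v ?b) @\<^sub>v (\<delta> 0 *\<^sub>v ?b)"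
      using c_mult[of a 0 ?b] a b by simp
    also have "\<delta> 0 *\<^sub>v ?b = 0\<^sub>v 0" by (intro eq_vecI) (auto simp: \<delta>_def)
    also have "(vec 1 (\<lambda>_. g) + \<phi> 0 *\<^sub>v ?b) @\<^sub>v 0\<^sub>v 0 = v"
      unfolding \<phi>0[OF b(2)] using v(1,2) by (intro eq_vecI) (auto simp: mult.commute)
    finally have "v = c 1 *\<^sub>v (a @\<^sub>v ?b)" ..
    moreover have "a @\<^sub>v ?b \<in> carrier_vec (r 1 + s 0)" using a(1) b(1) by (rule append_carrier_vec)
    ultimately show "v \<in> mat_image (c 1)"
      using mat_imageI[OF c, of "a @\<^sub>v ?b" 0] by simp
  qed
  have "mat_kernel (c (Suc i)) = mat_image (c (Suc (Suc i)))" for i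
  proof (intro equalityI subsetI)
    fix w assume "w \<in> mat_kernel (c (Suc i))"
    then have w: "w \<in> carrier_vec (r (Suc i) + s i)" "c (Suc i) *\<^sub>v w = 0\<^sub>v (r i + t i)"
      using mat_kernelD[OF c] by auto
    define a b where "a = vec_first w (r (Suc i))" and "b = vec_last w (s i)"
    have ab: "a \<in> carrier_vec (r (Suc i))" "b \<in> carrier_vec (s i)" "w = a @\<^sub>v b"
      using vec_first_last_append[OF w(1)] by (auto simp: a_def b_def)
    have da: "d (Suc i) *\<^sub>v a \<in> carrier_vec (r i)" and pb: "\<phi> i *\<^sub>v b \<in> carrier_vec (r i)"
      by (rule mult_mat_vec_carrier[OF d ab(1)], rule mult_mat_vec_carrier[OF \<phi>(1) ab(2)])
    have split: "0\<^sub>v (r i + t i) = 0\<^sub>v (r i) @\<^sub>v 0\<^sub>v (t i)" by (intro eq_vecI) auto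
    have "(d (Suc i) *\<^sub>v a + \<phi> i *\<^sub>v b) @\<^sub>v (\<delta> i *\<^sub>v b) = 0\<^sub>v (r i) @\<^sub>v 0\<^sub>v (t i)"
      using w(2) unfolding ab(3) c_mult[OF ab(1,2)] split .
    then have eqs: "d (Suc i) *\<^sub>v a + \<phi> i *\<^sub>v b = 0\<^sub>v (r i)" "\<delta> i *\<^sub>v b = 0\<^sub>v (t i)"
      using append_vec_eq[OF add_carrier_vec[OF da pb] zero_carrier_vec] by auto
    have "b \<in> mat_image (e (Suc i))"
    proof (cases i)
      \<comment> \<open>In degree 0 the kernel equation says \<open>u * b $ 0 \<in> J\<close>, and
        the colon condition replaces the exactness used in higher degrees.\<close>
      case 0
      have b: "b \<in> carrier_vec 1" using ab(2) 0 rs by simp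
      have "\<phi> 0 *\<^sub>v b = d 1 *\<^sub>v (- a)"
      proof -
        have "d 1 *\<^sub>v (- a) = - (d 1 *\<^sub>v a)"
          using d[of 0] ab(1) 0 by (intro eq_vecI) auto
        moreover have "\<phi> 0 *\<^sub>v b = - (d 1 *\<^sub>v a)"
          using add_vec_eq_0_imp_uminus[OF da pb eqs(1)] 0 by simp
        ultimately show ?thesis by simp
      qed
      then have "\<phi> 0 *\<^sub>v b \<in> mat_image (d 1)"
        using mat_imageI[OF d, of "- a" 0] ab(1) 0 by simp
      then have "u * b $ 0 \<in> J" unfolding \<phi>0[OF b] using resolution_image[OF r] by simp
      then show ?thesis using colon b 0 resolution_image[OF s] by (simp add: mult.commute)
    next
      case (Suc j)
      have "- (e i *\<^sub>v b) = 0\<^sub>v (s j)"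
        using eqs(2) e[of j] ab(2) Suc by (simp add: \<delta>_def t)
      then have "e i *\<^sub>v b = 0\<^sub>v (s j)"
        by (metis uminus_uminus_vec uminus_zero_vec)
      then show ?thesis
        using e[of j] ab(2) unfolding Suc resolution_exact[OF s, symmetric]
        by (intro mat_kernelI)
    qed
    then obtain x where x: "x \<in> carrier_vec (s (Suc i))" "b = e (Suc i) *\<^sub>v x"
      using e by (rule mat_imageE)
    have px: "\<phi> (Suc i) *\<^sub>v x \<in> carrier_vec (r (Suc i))" by (rule mult_mat_vec_carrier[OF \<phi>(1) x(1)])
    have "d (Suc i) *\<^sub>v (\<phi> (Suc i) *\<^sub>v x) = \<phi> i *\<^sub>v b"
      unfolding x(2) assoc_mult_mat_vec[OF d \<phi>(1) x(1), symmetric] \<phi>(3)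
      by (rule assoc_mult_mat_vec[OF \<phi>(1) e x(1)])
    then have "d (Suc i) *\<^sub>v (a + \<phi> (Suc i) *\<^sub>v x) = 0\<^sub>v (r i)"
      unfolding mult_add_distrib_mat_vec[OF d ab(1) px] using eqs(1) by simp
    then have "a + \<phi> (Suc i) *\<^sub>v x \<in> mat_image (d (Suc (Suc i)))"
      unfolding resolution_exact[OF r, symmetric]
      by (intro mat_kernelI[OF d]) (use ab(1) px in auto)
    then obtain y where y: "y \<in> carrier_vec (r (Suc (Suc i)))"
      "a + \<phi> (Suc i) *\<^sub>v x = d (Suc (Suc i)) *\<^sub>v y"
      using d by (rule mat_imageE)
    \<comment> \<open>The preimage is \<open>y @\<^sub>v - x\<close>: the minus sign undoes the one
      in \<open>\<delta>\<close>, and in the first block it removes the term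
      \<open>\<phi> (Suc i) *\<^sub>v x\<close> that was added to \<open>a\<close>.\<close>
    have mx: "- x \<in> carrier_vec (s (Suc i))" using x(1) by simp
    have "c (Suc (Suc i)) *\<^sub>v (y @\<^sub>v - x) = (d (Suc (Suc i)) *\<^sub>v y + \<phi> (Suc i) *\<^sub>v (- x)) @\<^sub>v (\<delta> (Suc i) *\<^sub>v (- x))"
      by (rule c_mult[OF y(1) mx])
    also have "d (Suc (Suc i)) *\<^sub>v y + \<phi> (Suc i) *\<^sub>v (- x) = a"
    proof -
      have "\<phi> (Suc i) *\<^sub>v (- x) = - (\<phi> (Suc i) *\<^sub>v x)"
        using \<phi>(1)[of "Suc i"] x(1) by (intro eq_vecI) auto
      then show ?thesis unfolding y(2)[symmetric] using ab(1) px by (intro eq_vecI) auto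
    qed
    also have "\<delta> (Suc i) *\<^sub>v (- x) = b"
      using e[of i] x by (intro eq_vecI) (auto simp: \<delta>_def)
    finally have "w = c (Suc (Suc i)) *\<^sub>v (y @\<^sub>v - x)" unfolding ab(3) ..
    then show "w \<in> mat_image (c (Suc (Suc i)))"
      using mat_imageI[OF c append_carrier_vec[OF y(1) mx]] by simp
  next
    fix w assume "w \<in> mat_image (c (Suc (Suc i)))"
    then obtain v where v: "v \<in> carrier_vec (r (Suc (Suc i)) + s (Suc i))" "w = c (Suc (Suc i)) *\<^sub>v v"
      using c by (rule mat_imageE)
    define y x where "y = vec_first v (r (Suc (Suc i)))" and "x = vec_last v (s (Suc i))"
    have y: "y \<in> carrier_vec (r (Suc (Suc i)))" and x: "x \<in> carrier_vec (s (Suc i))" and yx: "v = y @\<^sub>v x"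
      using vec_first_last_append[OF v(1)] by (auto simp: y_def x_def)
    define b where "b = - e (Suc i) *\<^sub>v x"
    have b: "b \<in> carrier_vec (s i)" using e[of i] x unfolding b_def by auto
    have dy: "d (Suc (Suc i)) *\<^sub>v y \<in> carrier_vec (r (Suc i))"
      and px: "\<phi> (Suc i) *\<^sub>v x \<in> carrier_vec (r (Suc i))"
      by (rule mult_mat_vec_carrier[OF d y], rule mult_mat_vec_carrier[OF \<phi>(1) x])
    have w: "w = (d (Suc (Suc i)) *\<^sub>v y + \<phi> (Suc i) *\<^sub>v x) @\<^sub>v b"
      unfolding v(2) yx c_mult[OF y x] by (simp add: \<delta>_def b_def)
    have eb: "\<phi> i *\<^sub>v b = - (\<phi> i *\<^sub>v (e (Suc i) *\<^sub>v x))"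
      using \<phi>(1)[of i] e[of i] x unfolding b_def by (intro eq_vecI) auto
    have "d (Suc i) *\<^sub>v (d (Suc (Suc i)) *\<^sub>v y) = 0\<^sub>v (r i)"
      unfolding assoc_mult_mat_vec[OF d d y, symmetric] resolution_complex[OF r]
      by (rule zero_mat_mult_vec[OF y])
    moreover have "d (Suc i) *\<^sub>v (\<phi> (Suc i) *\<^sub>v x) = \<phi> i *\<^sub>v (e (Suc i) *\<^sub>v x)"
      unfolding assoc_mult_mat_vec[OF d \<phi>(1) x, symmetric] \<phi>(3)
      by (rule assoc_mult_mat_vec[OF \<phi>(1) e x])
    moreover have "\<phi> i *\<^sub>v (e (Suc i) *\<^sub>v x) \<in> carrier_vec (r i)"
      by (rule mult_mat_vec_carrier[OF \<phi>(1) mult_mat_vec_carrier[OF e x]])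
    ultimately have "d (Suc i) *\<^sub>v (d (Suc (Suc i)) *\<^sub>v y + \<phi> (Suc i) *\<^sub>v x) + \<phi> i *\<^sub>v b = 0\<^sub>v (r i)"
      unfolding mult_add_distrib_mat_vec[OF d dy px] eb by (intro eq_vecI) auto
    moreover have "\<delta> i *\<^sub>v b = 0\<^sub>v (t i)"
    proof (cases i)
      case (Suc j)
      have "e i *\<^sub>v (e (Suc i) *\<^sub>v x) = 0\<^sub>v (s j)"
        unfolding Suc assoc_mult_mat_vec[OF e e x[unfolded Suc], symmetric] resolution_complex[OF s]
        by (rule zero_mat_mult_vec[OF x[unfolded Suc]])
      moreover have "\<delta> i *\<^sub>v b = e i *\<^sub>v (e (Suc i) *\<^sub>v x)"
        using e[of i] e[of j] x Suc unfolding b_def by (intro eq_vecI) (auto simp: \<delta>_def)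
      ultimately show ?thesis using Suc by (simp add: t)
    qed (auto simp: \<delta>_def t intro!: eq_vecI)
    ultimately have "c (Suc i) *\<^sub>v w = 0\<^sub>v (r i) @\<^sub>v 0\<^sub>v (t i)"
      unfolding w c_mult[OF add_carrier_vec[OF dy px] b] by simp
    also have "\<dots> = 0\<^sub>v (r i + t i)" by (intro eq_vecI) auto
    finally show "w \<in> mat_kernel (c (Suc i))"
      using c append_carrier_vec[OF add_carrier_vec[OF dy px] b] unfolding w[symmetric]
      by (intro mat_kernelI)
  qed
  then show ?thesis
    using c image rs unfolding free_resolution_def by (simp add: t)
qed


section \<open>Homogeneous matrices and linear resolutions\<close>

definition hom_mat :: "nat \<Rightarrow> ('v, 'k::comm_ring_1) mpoly mat \<Rightarrow> bool" where
  "hom_mat a A \<longleftrightarrow> (\<forall>p < dim_row A. \<forall>q < dim_col A. homogeneous (int a) (A $$ (p, q)))"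

lemma hom_part_mat_mult_right:
  fixes A B :: "('v::finite, 'k::comm_ring_1) mpoly mat"
  assumes "A \<in> carrier_mat nr n" "B \<in> carrier_mat n nc" "hom_mat a A"
  shows "map_mat (hom_part (a + b)) (A * B) = A * map_mat (hom_part b) B"
  using assms
  by (intro eq_matI) (auto simp: scalar_prod_def hom_part_sum hom_mat_def hom_part_mult intro!: sum.cong)

lemma hom_part_mat_mult_left:
  fixes A B :: "('v::finite, 'k::comm_ring_1) mpoly mat"
  assumes "A \<in> carrier_mat nr n" "B \<in> carrier_mat n nc" "hom_mat b B"
  shows "map_mat (hom_part (a + b)) (A * B) = map_mat (hom_part a) A * B"
proof -
  have "hom_part (a + b) (f * g) = hom_part a f * g" if "homogeneous (int b) g" for f g :: "('v, 'k) mpoly"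
    using hom_part_mult[OF that, of a f] by (simp add: ac_simps)
  then show ?thesis using assms
    by (intro eq_matI) (auto simp: scalar_prod_def hom_part_sum hom_mat_def intro!: sum.cong)
qed

text \<open>The free module of rank \<open>r (Suc i)\<close> is generated in degree \<open>D + i\<close>.\<close>

definition linear_resolution ::
  "('v::finite, 'k::comm_ring_1) mpoly set \<Rightarrow> nat \<Rightarrow> (nat \<Rightarrow> nat) \<Rightarrow> (nat \<Rightarrow> ('v, 'k) mpoly mat) \<Rightarrow> bool" where
  "linear_resolution J D r d \<longleftrightarrow> free_resolution J r d \<and>
     (\<forall>i. hom_mat (if i = 0 then D else 1) (d (Suc i)))"

text \<open>Shifted by the degree \<open>D\<close> of \<open>u\<close>, the module of index
  \<open>i\<close> in the resolution of \<open>L\<close> is generated in degree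
  \<open>D + i\<close>. The cone places it at index \<open>Suc i\<close>, where a linear resolution
  requires exactly this degree.\<close>

lemma linear_resolution_cone:
  fixes u :: "('v::finite, 'k::comm_ring_1) mpoly"
  assumes r: "linear_resolution J D r d" and s: "linear_resolution L 1 s e"
    and u: "homogeneous (int D) u" and colon: "\<And>f. f \<in> L \<longleftrightarrow> f * u \<in> J"
  shows "\<exists>c. linear_resolution {g + h * u | g h. g \<in> J} D (\<lambda>i. r i + (if i = 0 then 0 else s (i - 1))) c"
proof -
  have r': "free_resolution J r d" and s': "free_resolution L s e"
    using r s by (auto simp: linear_resolution_def)
  note d = resolution_carrier[OF r'] and e = resolution_carrier[OF s']
  have rs: "r 0 = 1" "s 0 = 1" using r' s' by (simp_all add: resolution_rank_0)
  let ?D = "\<lambda>i. if i = 0 then D else 1"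
  have hd: "hom_mat (?D i) (d (Suc i))" and he: "hom_mat 1 (e (Suc i))" for i
    using r s by (auto simp: linear_resolution_def split: if_splits)
  let ?u = "mat 1 1 (\<lambda>_. u)"
  have u_mult: "?u *\<^sub>v b = vec 1 (\<lambda>_. u * b $ 0)" if "b \<in> carrier_vec 1" for b
    using that by (intro eq_vecI) (auto simp: scalar_prod_def)
  obtain \<phi> where \<phi>: "\<phi> 0 = ?u" "\<And>i. \<phi> i \<in> carrier_mat (r i) (s i)"
      "\<And>i. d (Suc i) * \<phi> (Suc i) = \<phi> i * e (Suc i)"
  proof (rule chain_map_exists[OF r', of e s ?u])
    show "\<And>i. e (Suc i) * e (Suc (Suc i)) = 0\<^sub>m (s i) (s (Suc (Suc i)))"
      by (rule resolution_complex[OF s'])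
    show "?u *\<^sub>v (e 1 *\<^sub>v v) \<in> mat_image (d 1)" if "v \<in> carrier_vec (s 1)" for v
    proof -
      have "e 1 *\<^sub>v v \<in> mat_image (e 1)" using mat_imageI[OF e, of v 0] that by simp
      then have ev: "e 1 *\<^sub>v v \<in> carrier_vec 1" "(e 1 *\<^sub>v v) $ 0 \<in> L"
        using resolution_image[OF s'] by auto
      show ?thesis unfolding u_mult[OF ev(1)]
        using ev(2) colon resolution_image[OF r'] by (simp add: mult.commute)
    qed
  qed (use e rs in auto)
  \<comment> \<open>The lifted \<open>\<phi>\<close> may have entries of mixed degree. Its
    components of degree \<open>D\<close> in index 0 and of degree 1 afterwards still commute with
    the differentials, because these are homogeneous.\<close>
  define \<psi> where "\<psi> i = map_mat (hom_part (?D i)) (\<phi> i)" for i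
  have \<psi>: "\<psi> i \<in> carrier_mat (r i) (s i)" for i using \<phi>(2) by (simp add: \<psi>_def)
  have "\<psi> 0 = ?u" using u by (intro eq_matI) (auto simp: \<psi>_def \<phi>(1) hom_part_homogeneous)
  moreover have "d (Suc i) * \<psi> (Suc i) = \<psi> i * e (Suc i)" for i
  proof -
    have "d (Suc i) * \<psi> (Suc i) = map_mat (hom_part (?D i + 1)) (d (Suc i) * \<phi> (Suc i))"
      using hom_part_mat_mult_right[OF d \<phi>(2) hd, of i 1] by (simp add: \<psi>_def)
    also have "\<dots> = \<psi> i * e (Suc i)"
      unfolding \<phi>(3) \<psi>_def by (rule hom_part_mat_mult_left[OF \<phi>(2) e he])
    finally show ?thesis .
  qed
  moreover have "hom_mat (?D i) (\<psi> i)" for i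
    by (auto simp: hom_mat_def \<psi>_def intro: homogeneous_hom_part[of 1, simplified] homogeneous_hom_part)
  moreover define c where "c i = four_block_mat (d i) (\<psi> (i - 1))
     (0\<^sub>m (if i - 1 = 0 then 0 else s (i - 1 - 1)) (r i)) (if i - 1 = 0 then 0\<^sub>m 0 1 else - e (i - 1))" for i
  ultimately have "free_resolution {g + h * u | g h. g \<in> J} (\<lambda>i. r i + (if i = 0 then 0 else s (i - 1))) c"
    using mapping_cone[OF r' s' colon \<psi>] by (simp add: fun_eq_iff c_def[abs_def])
  moreover have "hom_mat (?D i) (c (Suc i))" for i
  proof -
    have "homogeneous (int (?D i)) (d (Suc i) $$ (p, q))" if "p < r i" "q < r (Suc i)" for p q
      using hd[of i] d[of i] that by (auto simp: hom_mat_def)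
    moreover have "homogeneous (int (?D i)) (\<psi> i $$ (p, q))" if "p < r i" "q < s i" for p q
      using \<open>hom_mat (?D i) (\<psi> i)\<close> \<psi>[of i] that unfolding hom_mat_def by auto
    moreover have "homogeneous 1 (- e i $$ (p, q))" if "i = Suc j" "p < s j" "q < s i" for p q j
      using he[of j] e[of j] that by (auto simp: hom_mat_def intro: homogeneous_uminus)
    ultimately show ?thesis
      using d[of i] \<psi>[of i] e[of "i - 1"] rs
      by (cases i) (auto simp: hom_mat_def c_def)
  qed
  ultimately show ?thesis unfolding linear_resolution_def by blast
qed

lemma minimal_graded_free_resolutionD:
  assumes "minimal_graded_free_resolution J F d"
  shows "free_resolution J (\<lambda>i. length (F i)) d" "minimal_mats (\<lambda>i. length (F i)) d"
  using assms unfolding minimal_graded_free_resolution_def free_resolution_def minimal_mats_def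
  by auto

text \<open>All entries have degree \<open>D\<close> or 1, both positive, so linearity already gives
  minimality. Comparing ranks in both directions justifies the definite description in
  \<open>betti\<close>.\<close>

lemma betti_linear_resolution:
  fixes J :: "('v::finite, 'k::field) mpoly set"
  assumes r: "linear_resolution J D r d" and D: "0 < D" and zero: "\<And>i. CARD('v) < i \<Longrightarrow> r i = 0"
  shows "betti J i = r i"
proof -
  have r': "free_resolution J r d" and hom: "hom_mat (if i = 0 then D else 1) (d (Suc i))" for i
    using r by (auto simp: linear_resolution_def)
  note d = resolution_carrier[OF r']
  have hom': "homogeneous (int (if i = 0 then D else 1)) (d (Suc i) $$ (p, q))"
    if "p < r i" "q < r (Suc i)" for i p q
    using hom[of i] d[of i] that unfolding hom_mat_def by auto
  have min: "minimal_mats r d"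
    unfolding minimal_mats_def using D by (auto intro!: homogeneous_imp_irrelevant[OF hom'])
  define F where "F i = (if i = 0 then [0] else replicate (r i) (int D + int i - 1))" for i
  have length: "length (F i) = r i" for i
    using resolution_rank_0[OF r'] by (simp add: F_def)
  have "homogeneous (F (Suc i) ! q - F i ! p) (d (Suc i) $$ (p, q))"
    if "p < length (F i)" "q < length (F (Suc i))" for i p q
  proof -
    have "F (Suc i) ! q - F i ! p = int (if i = 0 then D else 1)"
      using that unfolding length by (auto simp: F_def resolution_rank_0[OF r'])
    then show ?thesis using hom' that unfolding length by metis
  qed
  then have "minimal_graded_free_resolution J F d"
    unfolding minimal_graded_free_resolution_def
    using d resolution_image[OF r'] resolution_exact[OF r'] min zero
    by (auto simp: length minimal_mats_def F_def[of 0] length_0_conv[symmetric] simp del: length_0_conv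
        dest!: Suc_le_D)
  moreover have "length (F' i) = r i" if "minimal_graded_free_resolution J F' d'" for F' d'
    using minimal_resolution_rank_le[OF r' minimal_graded_free_resolutionD(1)[OF that] min, of i]
      minimal_resolution_rank_le[OF minimal_graded_free_resolutionD(1)[OF that] r'
        minimal_graded_free_resolutionD(2)[OF that], of i]
    by (rule antisym[rotated])
  ultimately show ?thesis
    unfolding betti_def using length by (intro the_equality) blast+
qed

section \<open>Counting bounded exponent sequences\<close>

text \<open>The bound is strict: exponents at most \<open>k\<close> correspond to
  \<open>bounded_lists (Suc k)\<close>, while the last Betti number leads to
  \<open>bounded_lists k\<close>.\<close>

fun bounded_lists :: "nat \<Rightarrow> nat \<Rightarrow> nat \<Rightarrow> nat list set" where
  "bounded_lists k 0 s = (if s = 0 then {[]} else {})"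
| "bounded_lists k (Suc n) s = (\<Union>x\<in>{x. x < k \<and> x \<le> s}. (#) x ` bounded_lists k n (s - x))"

lemma bounded_lists_iff:
  "xs \<in> bounded_lists k n s \<longleftrightarrow> length xs = n \<and> (\<forall>x\<in>set xs. x < k) \<and> sum_list xs = s"
proof (induction n arbitrary: xs s)
  case (Suc n)
  show ?case
    by (cases xs) (auto simp: Suc image_iff)
qed auto

lemma finite_bounded_lists: "finite (bounded_lists k n s)"
  by (induction n arbitrary: s) auto

lemma card_bounded_lists_Suc:
  "card (bounded_lists k (Suc n) s) = (\<Sum>x | x < k \<and> x \<le> s. card (bounded_lists k n (s - x)))"
proof -
  have "card (bounded_lists k (Suc n) s) =
      (\<Sum>x | x < k \<and> x \<le> s. card ((#) x ` bounded_lists k n (s - x)))"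
    by (subst bounded_lists.simps, rule card_UN_disjoint) (auto simp: finite_bounded_lists)
  then show ?thesis by (simp add: card_image)
qed

text \<open>
  The number of lists of \<open>n\<close> natural numbers with sum \<open>s\<close>. Negative sums are admitted so that the
  inclusion-exclusion formula for bounded entries needs no case distinction.
\<close>

definition num_lists :: "nat \<Rightarrow> int \<Rightarrow> int" where
  "num_lists n s = (if s < 0 then 0 else if n = 0 then of_bool (s = 0)
     else int ((nat s + n - 1) choose (n - 1)))"

lemma num_lists_step: "num_lists (Suc n) s = num_lists n s + num_lists (Suc n) (s - 1)"
proof (cases "s > 0")
  case True
  then obtain m where s: "s = int (Suc m)" by (metis gr0_conv_Suc zero_less_imp_eq_int)
  show ?thesis
    by (cases n) (auto simp: num_lists_def s nat_add_distrib)
qed (auto simp: num_lists_def)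

lemma sum_num_lists: "(\<Sum>x<q. num_lists n (s - int x)) = num_lists (Suc n) s - num_lists (Suc n) (s - int q)"
proof (induction q)
  case (Suc q)
  then show ?case using num_lists_step[of n "s - int q"] by (simp add: algebra_simps)
qed auto

text \<open>Inclusion-exclusion over the entries that are at least \<open>q\<close>: since
  \<open>s < 3 * q\<close>, no three entries can violate the bound at once.\<close>

lemma card_bounded_lists:
  assumes "s < 3 * q"
  shows "int (card (bounded_lists q n s)) =
    num_lists n (int s) - int n * num_lists n (int s - int q)
      + int (n choose 2) * num_lists n (int s - 2 * int q)"
  using assms
proof (induction n arbitrary: s)
  case 0
  then show ?case by (auto simp: num_lists_def)
next
  case (Suc n)
  let ?f = "\<lambda>s. num_lists n s - int n * num_lists n (s - int q) + int (n choose 2) * num_lists n (s - 2 * int q)"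
  have "int (card (bounded_lists q (Suc n) s)) = (\<Sum>x | x < q \<and> x \<le> s. ?f (int s - int x))"
    using Suc by (simp add: card_bounded_lists_Suc of_nat_diff del: bounded_lists.simps)
  \<comment> \<open>Terms with \<open>x > s\<close> may be added because \<open>num_lists\<close>
    vanishes on negative sums.\<close>
  also have "\<dots> = (\<Sum>x<q. ?f (int s - int x))"
    by (rule sum.mono_neutral_left) (auto simp: num_lists_def)
  also have "\<dots> = (\<Sum>x<q. num_lists n (int s - int x))
      - int n * (\<Sum>x<q. num_lists n (int s - int q - int x))
      + int (n choose 2) * (\<Sum>x<q. num_lists n (int s - 2 * int q - int x))"
    by (simp add: sum.distrib sum_subtractf sum_distrib_left algebra_simps)
  also have "\<dots> = num_lists (Suc n) (int s) - int (Suc n) * num_lists (Suc n) (int s - int q)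
      + int (Suc n choose 2) * num_lists (Suc n) (int s - 2 * int q)"
  proof -
    have "num_lists (Suc n) (int s - 2 * int q - int q) = 0"
      using Suc.prems by (simp add: num_lists_def)
    moreover have "Suc n choose 2 = n + (n choose 2)" by (simp add: numeral_2_eq_2)
    ultimately show ?thesis unfolding sum_num_lists by (simp add: algebra_simps)
  qed
  finally show ?case .
qed

section \<open>Counting sequences by their number of exchangeable positions\<close>

definition free_positions :: "nat \<Rightarrow> nat list \<Rightarrow> nat set" where
  "free_positions k xs = {i. i < length xs \<and> xs ! i < k \<and> (\<exists>j<length xs. i < j \<and> 0 < xs ! j)}"

lemma finite_free_positions: "finite (free_positions k xs)"
  by (rule finite_subset[of _ "{..<length xs}"]) (auto simp: free_positions_def)

lemma card_free_positions_Nil [simp]: "card (free_positions k []) = 0"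
  by (simp add: free_positions_def)

lemma card_free_positions_Cons:
  "card (free_positions k (x # xs)) =
    of_bool (x < k \<and> 0 < sum_list xs) + card (free_positions k xs)"
proof -
  have ex: "(\<exists>j<length xs. 0 < xs ! j) \<longleftrightarrow> 0 < sum_list xs"
    using sum_list_eq_0_iff[of xs] by (metis gr0I in_set_conv_nth not_less0)
  have "free_positions k (x # xs) =
     (if x < k \<and> 0 < sum_list xs then {0} else {}) \<union> Suc ` free_positions k xs" (is "?A = ?B")
  proof (intro Set.set_eqI)
    fix i
    show "i \<in> ?A \<longleftrightarrow> i \<in> ?B"
      by (cases i) (auto simp: free_positions_def Ex_less_Suc2 ex)
  qed
  moreover have "card (Suc ` free_positions k xs) = card (free_positions k xs)"
    by (simp add: card_image)
  ultimately show ?thesis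
    by (auto simp: finite_free_positions)
qed

lemma card_free_positions_sum_0: "sum_list xs = 0 \<Longrightarrow> card (free_positions k xs) = 0"
  by (induction xs) (auto simp: card_free_positions_Cons)

text \<open>The last position has nothing after it to be exchanged against, so it is never
  free.\<close>

lemma card_free_positions_less: "0 < sum_list xs \<Longrightarrow> card (free_positions k xs) < length xs"
proof (induction xs)
  case (Cons x xs)
  then show ?case
    by (cases "sum_list xs = 0") (auto simp: card_free_positions_Cons card_free_positions_sum_0)
qed auto

definition num_free :: "nat \<Rightarrow> nat \<Rightarrow> nat \<Rightarrow> nat \<Rightarrow> nat" where
  "num_free k n s j = card {xs \<in> bounded_lists (Suc k) n s. card (free_positions k xs) = j}"

lemma bounded_lists_0: "bounded_lists (Suc k) n 0 = {replicate n 0}"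
proof (rule Set.set_eqI)
  fix xs
  show "xs \<in> bounded_lists (Suc k) n 0 \<longleftrightarrow> xs \<in> {replicate n 0}"
    by (auto simp: bounded_lists_iff simp del: bounded_lists.simps intro!: replicate_eqI)
qed

lemma num_free_0: "num_free k n 0 j = of_bool (j = 0)"
  unfolding num_free_def bounded_lists_0
  by (cases "j = 0") (auto simp: card_free_positions_sum_0 sum_list_replicate Collect_conv_if)

text \<open>The first position is free exactly if its entry is below both \<open>k\<close> and
  \<open>s\<close>. The only other possible entry is \<open>min s k\<close>, which either exhausts
  the sum or attains the bound.\<close>

lemma num_free_Suc:
  assumes "0 < s"
  shows "num_free k (Suc n) s j =
    (\<Sum>x | x < k \<and> x < s. if j = 0 then 0 else num_free k n (s - x) (j - 1))
     + (if s < k then of_bool (j = 0) else num_free k n (s - k) j)"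
proof -
  have "{xs \<in> bounded_lists (Suc k) (Suc n) s. card (free_positions k xs) = j} =
    (\<Union>x\<in>{x. x < Suc k \<and> x \<le> s}. (#) x ` {xs \<in> bounded_lists (Suc k) n (s - x).
        of_bool (x < k \<and> 0 < sum_list xs) + card (free_positions k xs) = j})" (is "?A = (\<Union>x\<in>?X. _ ` ?B x)")
  proof (rule Set.set_eqI)
    fix ys
    show "ys \<in> ?A \<longleftrightarrow> ys \<in> (\<Union>x\<in>?X. (#) x ` ?B x)"
    proof (cases ys)
      case (Cons x xs)
      have "ys \<in> ?A \<longleftrightarrow> x \<in> ?X \<and> xs \<in> ?B x"
      proof -
        have "x # xs \<in> bounded_lists (Suc k) (Suc n) s \<longleftrightarrow> x < Suc k \<and> x \<le> s \<and> xs \<in> bounded_lists (Suc k) n (s - x)"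
          unfolding bounded_lists_iff by (simp add: eq_diff_iff) linarith
        then show ?thesis unfolding Cons mem_Collect_eq card_free_positions_Cons by (simp only: conj_assoc)
      qed
      then show ?thesis unfolding Cons by blast
    qed (auto simp: bounded_lists_iff simp del: bounded_lists.simps)
  qed
  then have "num_free k (Suc n) s j = card (\<Union>x\<in>?X. (#) x ` ?B x)"
    by (simp only: num_free_def)
  also have "\<dots> = (\<Sum>x\<in>?X. card ((#) x ` ?B x))"
    by (rule card_UN_disjoint) (auto simp: finite_bounded_lists)
  also have "\<dots> = (\<Sum>x\<in>?X. card (?B x))" by (simp add: card_image)
  also have "\<dots> = (\<Sum>x\<in>{x. x < k \<and> x < s} \<union> {min s k}. card (?B x))"
    by (rule sum.cong) auto
  also have "\<dots> = (\<Sum>x | x < k \<and> x < s. card (?B x)) + card (?B (min s k))"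
    by (subst sum.union_disjoint) auto
  also have "(\<Sum>x | x < k \<and> x < s. card (?B x)) =
     (\<Sum>x | x < k \<and> x < s. if j = 0 then 0 else num_free k n (s - x) (j - 1))"
  proof (intro sum.cong refl)
    fix x assume x: "x \<in> {x. x < k \<and> x < s}"
    have *: "?B x = {xs \<in> bounded_lists (Suc k) n (s - x). Suc (card (free_positions k xs)) = j}"
      using x by (intro Collect_cong conj_cong refl) (auto simp: bounded_lists_iff)
    show "card (?B x) = (if j = 0 then 0 else num_free k n (s - x) (j - 1))"
      unfolding * by (cases j) (auto simp: num_free_def)
  qed
  also have "card (?B (min s k)) = (if s < k then of_bool (j = 0) else num_free k n (s - k) j)"
  proof (cases "s < k")
    case True
    have c: "card (free_positions k (replicate n 0)) = 0"
      by (rule card_free_positions_sum_0) (simp add: sum_list_replicate)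
    have *: "?B s = {xs. xs = replicate n 0 \<and> j = 0}"
      unfolding diff_self_eq_0 bounded_lists_0 singleton_iff
      by (rule Collect_cong) (metis add_0 c less_irrefl of_bool_eq(1) sum_list_replicate mult_0_right)
    have "card (?B s) = of_bool (j = 0)" unfolding * by (cases "j = 0") simp_all
    then show ?thesis using True by (simp only: min.absorb1 less_imp_le if_True)
  next
    case False
    then show ?thesis by (simp add: num_free_def min_def)
  qed
  finally show ?thesis .
qed

text \<open>Hockey-stick summation stopped after \<open>q\<close> terms. In the count below, the
  remaining summand is the contribution of the one first entry that is not free.\<close>

lemma sum_choose_descending:
  "q \<le> s \<Longrightarrow> (\<Sum>x<q. ((s - x - 1) + j) choose j) + ((s - q + j) choose Suc j) = (s + j) choose Suc j"
proof (induction q)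
  case (Suc q)
  then have "(s - q + j) choose Suc j = ((s - Suc q + j) choose j) + ((s - Suc q + j) choose Suc j)"
    by (metis (no_types, lifting) Suc_diff_le Suc_le_D add_Suc binomial_Suc_Suc diff_Suc_Suc)
  then show ?case using Suc by simp
qed auto

text \<open>The formula has a bijective reason. Cut the list after each free position: a block
  \<open>k, ..., k, f\<close> with \<open>f < k\<close> encodes an arbitrary natural number by
  division with remainder by \<open>k\<close>, and the final block ends in the last positive entry
  and encodes a positive number. So the lists correspond to \<open>j\<close> natural numbers and one
  positive number with total \<open>s\<close>. At most \<open>(s - 1) div k\<close> entries equal to
  \<open>k\<close> occur besides the last positive one, and the third hypothesis makes all blocks
  fit into length \<open>n\<close>. The induction follows \<open>num_free_Suc\<close>.\<close>

lemma num_free_eq: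
  assumes "0 < s" "0 < k" "j + (s - 1) div k < n"
  shows "num_free k n s j = (s - 1 + j) choose j"
  using assms
proof (induction n arbitrary: s j)
  case (Suc n)
  have last: "(if s < k then of_bool (j = 0) else num_free k n (s - k) j) = 
      (if s \<le> k then of_bool (j = 0) else (s - k - 1 + j) choose j)"
  proof (cases "s \<le> k")
    case True then show ?thesis using num_free_0[of k n j] by auto
  next
    case False
    then have "(s - 1) div k = Suc ((s - k - 1) div k)"
      using Suc.prems by (subst div_if) (auto simp: algebra_simps)
    then have "num_free k n (s - k) j = (s - k - 1 + j) choose j"
      using Suc.prems False by (intro Suc.IH) auto
    then show ?thesis using False by auto
  qed
  show ?case
  proof (cases j)
    case 0
    then show ?thesis unfolding num_free_Suc[OF Suc.prems(1)] last by simp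
  next
    case (Suc i)
    have X: "{x. x < k \<and> x < s} = {..<min k s}" by auto
    have "(\<Sum>x | x < k \<and> x < s. if j = 0 then 0 else num_free k n (s - x) (j - 1)) =
       (\<Sum>x<min k s. (s - x - 1 + i) choose i)"
      unfolding X
    proof (intro sum.cong refl)
      fix x assume "x \<in> {..<min k s}"
      moreover have "(s - x - 1) div k \<le> (s - 1) div k" by (intro div_le_mono) auto
      ultimately have "num_free k n (s - x) i = (s - x - 1 + i) choose i"
        using Suc Suc.prems by (intro Suc.IH) auto
      then show "(if j = 0 then 0 else num_free k n (s - x) (j - 1)) = (s - x - 1 + i) choose i"
        using Suc by simp
    qed
    moreover have "(if s \<le> k then of_bool (j = 0) else (s - k - 1 + j) choose j) = (s - min k s + i) choose Suc i"
    proof (cases "s \<le> k")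
      case False
      then have "s - k - 1 + j = s - k + i" using Suc by simp
      then show ?thesis using False Suc by (simp add: min_def del: binomial_Suc_Suc)
    qed (use Suc in auto)
    ultimately show ?thesis
      using sum_choose_descending[of "min k s" s i] Suc Suc.prems
      unfolding num_free_Suc[OF Suc.prems(1)] last by simp
  qed
qed auto

text \<open>With the maximal number of free positions, all entries but the last are below
  \<open>k\<close> and the last is positive. Lowering the last entry by 1 leaves a list with all
  entries below \<open>k\<close>.\<close>

lemma num_free_top:
  assumes "0 < s" "0 < k"
  shows "num_free k (Suc n) s n = card (bounded_lists k (Suc n) (s - 1))"
  using assms
proof (induction n arbitrary: s)
  case 0
  have "num_free k 0 t 0 = of_bool (t = 0)" for t
    by (cases "t = 0") (simp add: num_free_0, simp add: num_free_def)
  then have "num_free k (Suc 0) s 0 = of_bool (s \<le> k)"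
    unfolding num_free_Suc[OF 0(1)] by auto
  moreover have "bounded_lists k (Suc 0) (s - 1) = (if s \<le> k then {[s - 1]} else {})"
    using 0 by (auto simp: bounded_lists_iff length_Suc_conv simp del: bounded_lists.simps)
  ultimately show ?case by auto
next
  case (Suc n)
  have "num_free k (Suc n) s' (Suc n) = 0" for s'
  proof -
    have "card (free_positions k xs) < Suc n" if "xs \<in> bounded_lists (Suc k) (Suc n) s'" for xs
      using that card_free_positions_less[of xs k] card_free_positions_sum_0[of xs k]
      by (cases "sum_list xs = 0") (auto simp: bounded_lists_iff simp del: bounded_lists.simps)
    then have "{xs \<in> bounded_lists (Suc k) (Suc n) s'. card (free_positions k xs) = Suc n} = {}"
      by fastforce
    then show ?thesis by (simp only: num_free_def card.empty)
  qed
  then have "num_free k (Suc (Suc n)) s (Suc n) = (\<Sum>x | x < k \<and> x < s. num_free k (Suc n) (s - x) n)"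
    using Suc unfolding num_free_Suc[OF Suc.prems(1)] by simp
  also have "\<dots> = (\<Sum>x | x < k \<and> x < s. card (bounded_lists k (Suc n) (s - x - 1)))"
    using Suc by (intro sum.cong refl) auto
  also have "\<dots> = (\<Sum>x | x < k \<and> x \<le> s - 1. card (bounded_lists k (Suc n) (s - 1 - x)))"
    using Suc.prems by (intro sum.cong) (auto simp del: bounded_lists.simps)
  finally show ?case by (simp only: card_bounded_lists_Suc)
qed

section \<open>Linear quotients\<close>

lemma linear_resolution_zero_ideal:
  "\<exists>d. linear_resolution ({0} :: ('v::finite, 'k::comm_ring_1) mpoly set) D (\<lambda>i. if i = 0 then 1 else 0) d"
proof -
  let ?r = "\<lambda>i. if i = 0 then 1 else 0 :: nat"
  let ?d = "\<lambda>i. 0\<^sub>m (?r (i - 1)) (?r i) :: ('v, 'k) mpoly mat"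
  have "{v \<in> carrier_vec 1. v $ 0 \<in> {0}} = {0\<^sub>v 1 :: ('v, 'k) mpoly vec}"
    by (auto intro!: eq_vecI)
  then have "free_resolution {0} ?r ?d"
    unfolding free_resolution_def mat_image_def mat_kernel_def
    by (auto simp: image_iff zero_mat_mult_vec intro!: eq_vecI bexI[of _ "0\<^sub>v 0"])
      (rule exI[of _ "0\<^sub>v 0"], simp)
  then have "linear_resolution {0} D ?r ?d"
    unfolding linear_resolution_def hom_mat_def by simp
  then show ?thesis by (rule exI[of _ ?d])
qed

abbreviation var_mon :: "'v \<Rightarrow> 'v mon" where
  "var_mon v \<equiv> Poly_Mapping.single v 1"

lemma mon_dvd_var_mon: "mon_dvd (var_mon v) m \<longleftrightarrow> 0 < Poly_Mapping.lookup m v"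
  by (auto simp: mon_dvd_def lookup_single when_def)

text \<open>The Koszul complex as an iterated cone: a new variable is a nonzerodivisor modulo the
  others, so the colon ideal is the old ideal itself and the ranks add up by Pascal's rule.\<close>

lemma linear_resolution_variables:
  fixes W :: "'v::finite set"
  shows "\<exists>d. linear_resolution (mon_ideal (var_mon ` W) :: ('v, 'k::comm_ring_1) mpoly set) 1 (\<lambda>i. card W choose i) d"
proof (induction W rule: finite_induct[OF finite])
  case 1
  have "(\<lambda>i. card {} choose i) = (\<lambda>i. if i = 0 then 1 else 0 :: nat)"
    by (auto simp: fun_eq_iff binomial_eq_0)
  then show ?case using linear_resolution_zero_ideal by simp
next
  case (2 v W)
  let ?J = "mon_ideal (var_mon ` W) :: ('v, 'k) mpoly set" and ?u = "monomial (var_mon v) :: ('v, 'k) mpoly"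
  obtain d where d: "linear_resolution ?J 1 (\<lambda>i. card W choose i) d" using 2 by blast
  have colon: "f \<in> ?J \<longleftrightarrow> f * ?u \<in> ?J" for f
  proof -
    have "(\<exists>a\<in>var_mon ` W. mon_dvd a (m + var_mon v)) \<longleftrightarrow> (\<exists>a\<in>var_mon ` W. mon_dvd a m)" for m
      unfolding bex_simps mon_dvd_var_mon using 2(2)
      by (intro bex_cong refl) (auto simp: lookup_add lookup_single when_def)
    from mon_ideal_colon[OF this] show ?thesis by blast
  qed
  have "homogeneous (int 1) ?u" using homogeneous_monomial[of "var_mon v"] by (simp del: One_nat_def)
  from linear_resolution_cone[OF d d this colon]
  obtain c where "linear_resolution {g + h * ?u | g h. g \<in> ?J} 1
     (\<lambda>i. (card W choose i) + (if i = 0 then 0 else card W choose (i - 1))) c" by blast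
  moreover have "{g + h * ?u | g h. g \<in> ?J} = mon_ideal (var_mon ` insert v W)"
    by (rule Set.set_eqI) (simp only: mon_ideal_insert mem_Collect_eq image_insert, blast)
  moreover have "(\<lambda>i. (card W choose i) + (if i = 0 then 0 else card W choose (i - 1))) = (\<lambda>i. card (insert v W) choose i)"
  proof
    fix i show "(card W choose i) + (if i = 0 then 0 else card W choose (i - 1)) = card (insert v W) choose i"
      using 2(1,2) by (cases i) (auto simp: add.commute)
  qed
  ultimately show ?case by auto
qed

section \<open>Bounded monomials in lexicographic order\<close>

definition bounded_mons :: "nat \<Rightarrow> nat \<Rightarrow> 'v::finite mon set" where
  "bounded_mons k s = {u. mon_degree u = s \<and> (\<forall>v. Poly_Mapping.lookup u v \<le> k)}"

text \<open>The index type carries no order, so exponent lists and the lexicographic comparison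
  refer to one fixed enumeration of the variables.\<close>

locale variable_order =
  fixes e :: "nat \<Rightarrow> 'v::finite"
  assumes bij: "bij_betw e {..<CARD('v)} UNIV"
begin

definition exponents :: "'v mon \<Rightarrow> nat list" where
  "exponents u = map (\<lambda>i. Poly_Mapping.lookup u (e i)) [0..<CARD('v)]"

lemma length_exponents [simp]: "length (exponents u) = CARD('v)"
  by (simp add: exponents_def)

lemma nth_exponents: "i < CARD('v) \<Longrightarrow> exponents u ! i = Poly_Mapping.lookup u (e i)"
  by (simp add: exponents_def)

lemma enumE: obtains i where "i < CARD('v)" "v = e i"
  using bij unfolding bij_betw_def by (metis UNIV_I imageE lessThan_iff)

lemma sum_enum: "(\<Sum>v\<in>UNIV. f v) = (\<Sum>i<CARD('v). f (e i))"
  by (rule sum.reindex_bij_betw[OF bij, symmetric])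

lemma sum_list_exponents: "sum_list (exponents u) = mon_degree u"
  by (simp add: mon_degree_eq_sum sum_enum exponents_def sum_list_sum_nth atLeast0LessThan)

lemma bij_exponents: "bij_betw exponents (bounded_mons k s) (bounded_lists (Suc k) CARD('v) s)"
proof (rule bij_betwI')
  fix u u' :: "'v mon"
  have "u = u'" if "exponents u = exponents u'"
  proof (rule poly_mapping_eqI)
    fix v
    obtain i where "i < CARD('v)" "v = e i" by (rule enumE)
    then show "Poly_Mapping.lookup u v = Poly_Mapping.lookup u' v"
      using that by (metis nth_exponents)
  qed
  then show "(exponents u = exponents u') = (u = u')" by blast
next
  fix u :: "'v mon" assume "u \<in> bounded_mons k s"
  then show "exponents u \<in> bounded_lists (Suc k) CARD('v) s"
    unfolding bounded_lists_iff by (auto simp: bounded_mons_def sum_list_exponents) (auto simp: exponents_def less_Suc_eq_le)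
next
  fix xs assume xs: "xs \<in> bounded_lists (Suc k) CARD('v) s"
  define u :: "'v mon" where "u = Abs_poly_mapping (\<lambda>v. xs ! (inv_into {..<CARD('v)} e v))"
  have "Poly_Mapping.lookup u (e i) = xs ! i" if "i < CARD('v)" for i
    using bij_betw_inv_into_left[OF bij, of i] that by (simp add: u_def)
  then have "exponents u = xs"
    using xs by (intro nth_equalityI) (auto simp: nth_exponents bounded_lists_iff simp del: bounded_lists.simps)
  moreover have "u \<in> bounded_mons k s"
  proof -
    have "Poly_Mapping.lookup u v \<le> k" for v
    proof -
      obtain i where i: "i < CARD('v)" "v = e i" by (rule enumE)
      then have "Poly_Mapping.lookup u v \<in> set xs"
        using \<open>exponents u = xs\<close> nth_exponents[of i u] by (metis length_exponents nth_mem)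
      then show ?thesis using xs by (auto simp: bounded_lists_iff less_Suc_eq_le simp del: bounded_lists.simps)
    qed
    moreover have "mon_degree u = s"
      using xs sum_list_exponents[of u] \<open>exponents u = xs\<close> by (simp add: bounded_lists_iff del: bounded_lists.simps)
    ultimately show ?thesis by (simp add: bounded_mons_def)
  qed
  ultimately show "\<exists>u\<in>bounded_mons k s. xs = exponents u" by blast
qed

lemma finite_bounded_mons: "finite (bounded_mons k s :: 'v mon set)"
  using bij_betw_finite[OF bij_exponents] finite_bounded_lists by blast

definition lex_greater :: "'v mon \<Rightarrow> 'v mon \<Rightarrow> bool" where
  "lex_greater b a \<longleftrightarrow> (\<exists>i<CARD('v). (\<forall>j<i. Poly_Mapping.lookup b (e j) = Poly_Mapping.lookup a (e j)) \<and>
     Poly_Mapping.lookup a (e i) < Poly_Mapping.lookup b (e i))"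

lemma lex_greater_irrefl: "\<not> lex_greater a a"
  by (simp add: lex_greater_def)

lemma lex_greater_trans:
  assumes "lex_greater a b" "lex_greater b c"
  shows "lex_greater a c"
proof -
  obtain i j where i: "i < CARD('v)" "\<forall>l<i. Poly_Mapping.lookup a (e l) = Poly_Mapping.lookup b (e l)"
      "Poly_Mapping.lookup b (e i) < Poly_Mapping.lookup a (e i)"
    and j: "j < CARD('v)" "\<forall>l<j. Poly_Mapping.lookup b (e l) = Poly_Mapping.lookup c (e l)"
      "Poly_Mapping.lookup c (e j) < Poly_Mapping.lookup b (e j)"
    using assms unfolding lex_greater_def by blast
  show ?thesis
    unfolding lex_greater_def
    by (rule exI[of _ "min i j"], cases i j rule: linorder_cases) (use i j in \<open>auto simp: min_def\<close>)
qed

lemma lex_greater_total: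
  assumes "a \<noteq> b"
  shows "lex_greater a b \<or> lex_greater b a"
proof -
  let ?P = "\<lambda>i. i < CARD('v) \<and> Poly_Mapping.lookup a (e i) \<noteq> Poly_Mapping.lookup b (e i)"
  have "\<exists>i. ?P i"
  proof (rule ccontr)
    assume no: "\<not> (\<exists>i. ?P i)"
    have "a = b"
    proof (rule poly_mapping_eqI)
      fix v
      obtain i where "i < CARD('v)" "v = e i" by (rule enumE)
      then show "Poly_Mapping.lookup a v = Poly_Mapping.lookup b v" using no by blast
    qed
    then show False using assms by contradiction
  qed
  then have "\<exists>i. ?P i \<and> (\<forall>j<i. \<not> ?P j)" by (rule exists_least_iff[THEN iffD1])
  then obtain i where "?P i \<and> (\<forall>j<i. \<not> ?P j)" ..
  then have i: "?P i" "\<forall>j<i. \<not> ?P j" by (rule conjunct1, rule conjunct2)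
  have eq: "\<forall>j<i. Poly_Mapping.lookup a (e j) = Poly_Mapping.lookup b (e j)"
    using i by (meson less_trans)
  show ?thesis
  proof (cases "Poly_Mapping.lookup a (e i) < Poly_Mapping.lookup b (e i)")
    case True
    have "lex_greater b a" unfolding lex_greater_def
      by (rule exI[of _ i], intro conjI) (use i(1) eq True in auto)
    then show ?thesis ..
  next
    case False
    have "lex_greater a b" unfolding lex_greater_def
      by (rule exI[of _ i], intro conjI) (use i(1) eq False in auto)
    then show ?thesis ..
  qed
qed

definition free_vars :: "nat \<Rightarrow> 'v mon \<Rightarrow> 'v set" where
  "free_vars k u = e ` free_positions k (exponents u)"

lemma card_free_vars: "card (free_vars k u) = card (free_positions k (exponents u))"
  unfolding free_vars_def
  by (rule card_image, rule inj_on_subset[OF bij_betw_imp_inj_on[OF bij]]) (auto simp: free_positions_def)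

lemma free_vars_iff:
  "v \<in> free_vars k u \<longleftrightarrow> (\<exists>i j. i < j \<and> j < CARD('v) \<and> v = e i \<and>
     Poly_Mapping.lookup u (e i) < k \<and> 0 < Poly_Mapping.lookup u (e j))"
proof
  assume "\<exists>i j. i < j \<and> j < CARD('v) \<and> v = e i \<and>
     Poly_Mapping.lookup u (e i) < k \<and> 0 < Poly_Mapping.lookup u (e j)"
  then obtain i j where "i < j" "j < CARD('v)" "v = e i" "Poly_Mapping.lookup u (e i) < k"
    "0 < Poly_Mapping.lookup u (e j)" by blast
  then show "v \<in> free_vars k u"
    unfolding free_vars_def free_positions_def
    by (intro image_eqI[of _ _ i] CollectI conjI exI[of _ j]) (simp_all add: nth_exponents)
next
  assume "v \<in> free_vars k u"
  then obtain i j where "v = e i" "i < CARD('v)" "exponents u ! i < k" "j < CARD('v)" "i < j" "0 < exponents u ! j"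
    unfolding free_vars_def free_positions_def by auto
  then show "\<exists>i j. i < j \<and> j < CARD('v) \<and> v = e i \<and>
     Poly_Mapping.lookup u (e i) < k \<and> 0 < Poly_Mapping.lookup u (e j)"
    by (intro exI[of _ i] exI[of _ j]) (simp add: nth_exponents)
qed

text \<open>
  The bounded monomials of fixed degree, taken in decreasing lexicographic order, have linear
  quotients: a variable \<open>v\<close> can be exchanged against a later variable of \<open>a\<close> exactly if \<open>v\<close> is free.
\<close>

lemma bounded_mons_colon:
  assumes a: "a \<in> bounded_mons k s"
  shows "(\<exists>b\<in>{b \<in> bounded_mons k s. lex_greater b a}. mon_dvd b (m + a)) \<longleftrightarrow>
    (\<exists>x\<in>var_mon ` free_vars k a. mon_dvd x m)"
proof
  assume "\<exists>b\<in>{b \<in> bounded_mons k s. lex_greater b a}. mon_dvd b (m + a)"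
  then obtain b i where b: "b \<in> bounded_mons k s" "mon_dvd b (m + a)" and i: "i < CARD('v)"
    "\<forall>j<i. Poly_Mapping.lookup b (e j) = Poly_Mapping.lookup a (e j)"
    "Poly_Mapping.lookup a (e i) < Poly_Mapping.lookup b (e i)"
    unfolding lex_greater_def by blast
  \<comment> \<open>Otherwise \<open>b\<close> would be at least \<open>a\<close> in every exponent
    and larger at \<open>e i\<close>, contradicting equality of degrees.\<close>
  have "\<exists>j. i < j \<and> j < CARD('v) \<and> 0 < Poly_Mapping.lookup a (e j)"
  proof (rule ccontr)
    assume "\<not> ?thesis"
    then have "Poly_Mapping.lookup a (e j) \<le> Poly_Mapping.lookup b (e j)" if "j < CARD('v)" for j
      using i that by (cases j i rule: linorder_cases) auto
    then have "(\<Sum>j<CARD('v). Poly_Mapping.lookup a (e j)) < (\<Sum>j<CARD('v). Poly_Mapping.lookup b (e j))"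
      using i by (intro sum_strict_mono_ex1) auto
    then show False using a b(1) by (simp add: bounded_mons_def mon_degree_eq_sum sum_enum)
  qed
  moreover have "Poly_Mapping.lookup a (e i) < k"
    using i(3) b(1) by (auto simp: bounded_mons_def intro: less_le_trans)
  ultimately have "e i \<in> free_vars k a" unfolding free_vars_iff by blast
  moreover have "0 < Poly_Mapping.lookup m (e i)"
    using i(3) b(2) unfolding mon_dvd_def lookup_add
    by (metis add_0 gr0I not_le)
  then have "mon_dvd (var_mon (e i)) m" unfolding mon_dvd_var_mon .
  ultimately show "\<exists>x\<in>var_mon ` free_vars k a. mon_dvd x m"
    by (intro bexI[of _ "var_mon (e i)"] imageI)
next
  assume "\<exists>x\<in>var_mon ` free_vars k a. mon_dvd x m"
  then obtain v where "v \<in> free_vars k a" and "0 < Poly_Mapping.lookup m v"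
    unfolding bex_simps mon_dvd_var_mon by (elim bexE)
  then obtain i j where ij: "i < j" "j < CARD('v)" "Poly_Mapping.lookup a (e i) < k"
    "0 < Poly_Mapping.lookup a (e j)" and m: "0 < Poly_Mapping.lookup m (e i)"
    unfolding free_vars_iff by blast
  have ne: "e i' \<noteq> e j'" if "i' < j'" "j' \<le> j" for i' j'
    using inj_on_eq_iff[OF bij_betw_imp_inj_on[OF bij], of i' j'] that ij by auto
  \<comment> \<open>Trading one factor \<open>e j\<close> of \<open>a\<close> for the earlier
    variable \<open>e i\<close> keeps the degree and the bound and makes the monomial
    lexicographically greater.\<close>
  define c where "c = a - var_mon (e j)"
  define b where "b = c + var_mon (e i)"
  have a_eq: "a = c + var_mon (e j)"
    using ij by (intro poly_mapping_eqI) (auto simp: c_def lookup_add lookup_minus lookup_single when_def)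
  have lb: "Poly_Mapping.lookup b v = (if v = e i then Suc (Poly_Mapping.lookup a v)
      else if v = e j then Poly_Mapping.lookup a v - 1 else Poly_Mapping.lookup a v)" for v
    using ne[OF ij(1)] by (auto simp: b_def c_def lookup_add lookup_minus lookup_single when_def)
  have "mon_degree b = mon_degree a"
    by (subst a_eq) (simp add: b_def mon_degree_add del: One_nat_def)
  moreover have "Poly_Mapping.lookup b v \<le> k" for v
  proof -
    have "Poly_Mapping.lookup a v \<le> k" using a by (simp add: bounded_mons_def)
    then show ?thesis unfolding lb using ij(3) by auto
  qed
  ultimately have "b \<in> bounded_mons k s" using a by (simp add: bounded_mons_def)
  moreover have "lex_greater b a"
    unfolding lex_greater_def lb
  proof (intro exI[of _ i] conjI allI impI)
    fix l assume "l < i"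
    then have "e l \<noteq> e i" "e l \<noteq> e j" using ne ij by auto
    then show "(if e l = e i then Suc (Poly_Mapping.lookup a (e l)) else if e l = e j
        then Poly_Mapping.lookup a (e l) - 1 else Poly_Mapping.lookup a (e l)) = Poly_Mapping.lookup a (e l)"
      by simp
  qed (use ij in auto)
  moreover have "mon_dvd b (m + a)"
    using m unfolding mon_dvd_def lb lookup_add by auto
  ultimately show "\<exists>b\<in>{b \<in> bounded_mons k s. lex_greater b a}. mon_dvd b (m + a)"
    by (intro bexI[of _ b] CollectI conjI)
qed

text \<open>Upward closed sets are the initial segments of the decreasing order. Removing the
  smallest element \<open>a\<close> leaves exactly the bounded monomials above \<open>a\<close>, for
  which the colon ideal is known.\<close>

lemma linear_resolution_upper_set:
  fixes U :: "'v mon set"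
  assumes "U \<subseteq> bounded_mons k s"
    and "\<And>a b. a \<in> U \<Longrightarrow> b \<in> bounded_mons k s \<Longrightarrow> lex_greater b a \<Longrightarrow> b \<in> U"
  shows "\<exists>d. linear_resolution (mon_ideal U :: ('v, 'k::comm_ring_1) mpoly set) s
    (\<lambda>i. if i = 0 then 1 else \<Sum>u\<in>U. card (free_vars k u) choose (i - 1)) d"
  using assms
proof (induction "card U" arbitrary: U)
  case 0
  have "finite U" using 0(2) finite_bounded_mons by (rule finite_subset)
  then have "U = {}" using 0(1) by simp
  then show ?case using linear_resolution_zero_ideal[of s] by (simp only: mon_ideal_empty sum.empty)
next
  case (Suc c)
  have fin: "finite U" using Suc(3) finite_bounded_mons by (rule finite_subset)
  have "asymp_on U lex_greater" "transp_on U lex_greater"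
    using lex_greater_irrefl lex_greater_trans unfolding asymp_on_def transp_on_def by blast+
  moreover have "U \<noteq> {}" using Suc(2) by auto
  \<comment> \<open>A maximal element for \<open>lex_greater\<close>, read as a strict order, is the
    lexicographically smallest monomial of \<open>U\<close>.\<close>
  ultimately obtain a where "a \<in> U" "\<forall>b\<in>U. b \<noteq> a \<longrightarrow> \<not> lex_greater a b"
    using Finite_Set.bex_max_element[OF fin] by blast
  then have a: "a \<in> U" "\<And>b. b \<in> U \<Longrightarrow> \<not> lex_greater a b"
    using lex_greater_irrefl by (blast, metis)
  let ?U = "U - {a}"
  have U: "?U = {b \<in> bounded_mons k s. lex_greater b a}"
  proof (intro equalityI subsetI)
    fix b assume "b \<in> ?U"
    then show "b \<in> {b \<in> bounded_mons k s. lex_greater b a}"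
      using a(2)[of b] lex_greater_total[of a b] Suc(3) by auto
  next
    fix b assume "b \<in> {b \<in> bounded_mons k s. lex_greater b a}"
    then show "b \<in> ?U" using Suc(4)[OF a(1), of b] lex_greater_irrefl[of a] by auto
  qed
  have "c = card ?U" using Suc(2) a(1) fin by simp
  moreover have "?U \<subseteq> bounded_mons k s" using Suc(3) by blast
  moreover have "b \<in> ?U" if "x \<in> ?U" "b \<in> bounded_mons k s" "lex_greater b x" for x b
    using that(1) Suc(4)[of x b, OF _ that(2,3)] a(2)[of x] that(3) by auto
  ultimately obtain d where d: "linear_resolution (mon_ideal ?U :: ('v, 'k) mpoly set) s
    (\<lambda>i. if i = 0 then 1 else \<Sum>u\<in>?U. card (free_vars k u) choose (i - 1)) d"
    using Suc(1)[of ?U] by blast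
  obtain f where f: "linear_resolution (mon_ideal (var_mon ` free_vars k a) :: ('v, 'k) mpoly set) 1
    (\<lambda>i. card (free_vars k a) choose i) f"
    using linear_resolution_variables by blast
  have av: "a \<in> bounded_mons k s" using a Suc(3) by blast
  have "homogeneous (int s) (monomial a :: ('v, 'k) mpoly)"
    using homogeneous_monomial[of a] av by (simp add: bounded_mons_def)
  moreover have "p \<in> mon_ideal (var_mon ` free_vars k a) \<longleftrightarrow> p * monomial a \<in> mon_ideal ?U" for p :: "('v, 'k) mpoly"
    unfolding U by (rule mon_ideal_colon[OF bounded_mons_colon[OF av], symmetric])
  ultimately obtain c where c: "linear_resolution {g + h * monomial a | g h. g \<in> mon_ideal ?U} s
     (\<lambda>i. (if i = 0 then 1 else \<Sum>u\<in>?U. card (free_vars k u) choose (i - 1)) +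
       (if i = 0 then 0 else card (free_vars k a) choose (i - 1))) (c :: nat \<Rightarrow> ('v, 'k) mpoly mat)"
    using linear_resolution_cone[OF d f] by blast
  have "{g + h * monomial a | g h. g \<in> mon_ideal ?U} = (mon_ideal U :: ('v, 'k) mpoly set)"
    unfolding insert_Diff[OF a(1), symmetric, THEN arg_cong, of mon_ideal]
    by (rule Set.set_eqI) (simp only: mon_ideal_insert mem_Collect_eq, blast)
  moreover have "(\<lambda>i. (if i = 0 then 1 else \<Sum>u\<in>?U. card (free_vars k u) choose (i - 1)) +
       (if i = 0 then 0 else card (free_vars k a) choose (i - 1))) =
     (\<lambda>i. if i = 0 then 1 else \<Sum>u\<in>U. card (free_vars k u) choose (i - 1))"
    by (rule ext) (simp add: sum.remove[OF fin a(1)])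
  ultimately have "linear_resolution (mon_ideal U) s
    (\<lambda>i. if i = 0 then 1 else \<Sum>u\<in>U. card (free_vars k u) choose (i - 1)) c"
    using c by (simp only:)
  then show ?case by blast
qed

lemma betti_bounded_mons:
  assumes "0 < s" "0 < i"
  shows "betti (mon_ideal (bounded_mons k s) :: ('v, 'k::field) mpoly set) i =
    (\<Sum>j<CARD('v). num_free k CARD('v) s j * (j choose (i - 1)))"
proof -
  let ?V = "bounded_mons k s :: 'v mon set" and ?L = "bounded_lists (Suc k) CARD('v) s"
  let ?r = "\<lambda>i. if i = 0 then 1 else \<Sum>u\<in>?V. card (free_vars k u) choose (i - 1)"
  have less: "card (free_positions k xs) < CARD('v)" if "xs \<in> ?L" for xs
    using card_free_positions_less[of xs k] that assms
    by (simp add: bounded_lists_iff del: bounded_lists.simps)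
  have r: "?r i = (\<Sum>xs\<in>?L. card (free_positions k xs) choose (i - 1))" if "0 < i" for i
    using that sum.reindex_bij_betw[OF bij_exponents, of "\<lambda>xs. card (free_positions k xs) choose (i - 1)" k s]
    by (simp add: card_free_vars)
  obtain d where "linear_resolution (mon_ideal ?V :: ('v, 'k) mpoly set) s ?r d"
    using linear_resolution_upper_set[of ?V k s] by blast
  \<comment> \<open>This is the length bound contained in
    \<open>minimal_graded_free_resolution\<close>; it holds because no generator has all variables
    free.\<close>
  moreover have "?r i = 0" if "CARD('v) < i" for i
  proof -
    have "card (free_positions k xs) choose (i - 1) = 0" if "xs \<in> ?L" for xs
      using less[OF that] \<open>CARD('v) < i\<close> by (intro binomial_eq_0) linarith
    then show ?thesis using r[of i] \<open>CARD('v) < i\<close> by (simp del: bounded_lists.simps)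
  qed
  ultimately have "betti (mon_ideal ?V :: ('v, 'k) mpoly set) i = ?r i"
    by (rule betti_linear_resolution[OF _ assms(1)])
  also have "\<dots> = (\<Sum>xs\<in>?L. card (free_positions k xs) choose (i - 1))" by (rule r[OF assms(2)])
  also have "\<dots> = (\<Sum>j<CARD('v). \<Sum>xs | xs \<in> ?L \<and> card (free_positions k xs) = j. card (free_positions k xs) choose (i - 1))"
    using less finite_bounded_lists[of "Suc k" "CARD('v)" s] by (intro sum.group[symmetric]) auto
  also have "\<dots> = (\<Sum>j<CARD('v). num_free k CARD('v) s j * (j choose (i - 1)))"
    by (simp add: num_free_def)
  finally show ?thesis .
qed

end

section \<open>Powers of the ideal and inversion of the linear relations\<close>

lemma mon_ideal_product:
  fixes G H :: "'v mon set"
  shows "ideal_generated {a * b | a b. a \<in> mon_ideal G \<and> b \<in> mon_ideal H} =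
    (mon_ideal {g + h | g h. g \<in> G \<and> h \<in> H} :: ('v, 'k::comm_ring_1) mpoly set)"
proof (rule equalityI)
  let ?P = "{a * b | a b. a \<in> mon_ideal G \<and> b \<in> mon_ideal H} :: ('v, 'k) mpoly set"
  have sub: "a * b \<in> mon_ideal {g + h | g h. g \<in> G \<and> h \<in> H}"
    if a: "a \<in> mon_ideal G" and b: "b \<in> mon_ideal H" for a b :: "('v, 'k) mpoly"
    unfolding mon_ideal_def mem_Collect_eq
  proof
    fix m assume "m \<in> Poly_Mapping.keys (a * b)"
    then obtain p q where pq: "p \<in> Poly_Mapping.keys a" "q \<in> Poly_Mapping.keys b" "m = p + q"
      using keys_mult[of a b] by blast
    then obtain g h where gh: "g \<in> G" "mon_dvd g p" "h \<in> H" "mon_dvd h q"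
      using a b unfolding mon_ideal_def by blast
    then have "mon_dvd (g + h) m"
      unfolding pq(3) mon_dvd_def lookup_add by (auto intro: add_mono)
    then show "\<exists>x\<in>{g + h | g h. g \<in> G \<and> h \<in> H}. mon_dvd x m" using gh by blast
  qed
  show "ideal_generated ?P \<subseteq> mon_ideal {g + h | g h. g \<in> G \<and> h \<in> H}"
    unfolding ideal_generated_monomials[symmetric] ideal_generated_def
    by (rule ring_as_module.span_minimal)
      (use sub in \<open>auto simp: ideal_generated_monomials[symmetric] ideal_generated_def\<close>)
  have "monomial ` {g + h | g h. g \<in> G \<and> h \<in> H} \<subseteq> ?P"
  proof
    fix x :: "('v, 'k) mpoly" assume "x \<in> monomial ` {g + h | g h. g \<in> G \<and> h \<in> H}"
    then obtain g h where gh: "g \<in> G" "h \<in> H" and x: "x = monomial (g + h)" by blast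
    have "x = monomial g * monomial h" by (simp add: x monomial_def mult_single)
    moreover have "(monomial g :: ('v, 'k) mpoly) \<in> mon_ideal G" "(monomial h :: ('v, 'k) mpoly) \<in> mon_ideal H"
      using gh unfolding ideal_generated_monomials[symmetric] ideal_generated_def
      by (auto intro: ring_as_module.span_base)
    ultimately show "x \<in> ?P" by blast
  qed
  then show "mon_ideal {g + h | g h. g \<in> G \<and> h \<in> H} \<subseteq> ideal_generated ?P"
    unfolding ideal_generated_monomials[symmetric] ideal_generated_def
    by (rule ring_as_module.span_mono)
qed

text \<open>The square-free factor \<open>g\<close> must contain every variable of exponent
  \<open>Suc k\<close> (the set \<open>T\<close>) and may use only variables of positive exponent
  (the set \<open>P\<close>). Degree \<open>3 * Suc k\<close> with exponents at most
  \<open>Suc k\<close> forces \<open>card T \<le> 3 \<le> card P\<close>, so a suitable triple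
  \<open>Q\<close> lies between them.\<close>

lemma bounded_mons_Suc:
  "(bounded_mons (Suc k) (3 * Suc k) :: 'v::finite mon set) =
    {g + h | g h. g \<in> bounded_mons 1 3 \<and> h \<in> bounded_mons k (3 * k)}"
proof (intro equalityI subsetI)
  fix u :: "'v mon" assume "u \<in> {g + h | g h. g \<in> bounded_mons 1 3 \<and> h \<in> bounded_mons k (3 * k)}"
  then show "u \<in> bounded_mons (Suc k) (3 * Suc k)"
    unfolding bounded_mons_def
    by (auto simp: mon_degree_add lookup_add) (metis One_nat_def add_mono plus_1_eq_Suc)
next
  fix u :: "'v mon" assume u: "u \<in> bounded_mons (Suc k) (3 * Suc k)"
  then have deg: "(\<Sum>v\<in>UNIV. Poly_Mapping.lookup u v) = 3 * Suc k"
    and le: "Poly_Mapping.lookup u v \<le> Suc k" for v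
    by (auto simp: bounded_mons_def mon_degree_eq_sum)
  define T where "T = {v. Poly_Mapping.lookup u v = Suc k}"
  define P where "P = {v. 0 < Poly_Mapping.lookup u v}"
  have "card T * Suc k = (\<Sum>v\<in>T. Poly_Mapping.lookup u v)" by (simp add: T_def)
  also have "\<dots> \<le> 3 * Suc k" unfolding deg[symmetric] by (rule sum_mono2) auto
  finally have cT: "card T \<le> 3" unfolding mult_le_cancel2 by simp
  have "3 * Suc k = (\<Sum>v\<in>P. Poly_Mapping.lookup u v)"
    unfolding deg[symmetric] by (rule sum.mono_neutral_right) (auto simp: P_def)
  also have "\<dots> \<le> card P * Suc k" using sum_bounded_above[of P "Poly_Mapping.lookup u", OF le] by simp
  finally have cP: "3 \<le> card P" unfolding mult_le_cancel2 by simp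
  have "T \<subseteq> P" by (auto simp: T_def P_def)
  then obtain Q where Q: "T \<subseteq> Q" "Q \<subseteq> P" "card Q = 3"
    using exists_subset_between[OF cT cP] by auto
  define g :: "'v mon" where "g = (\<Sum>v\<in>Q. Poly_Mapping.single v 1)"
  have lg: "Poly_Mapping.lookup g v = of_bool (v \<in> Q)" for v
  proof -
    have "Poly_Mapping.lookup g v = (\<Sum>w\<in>Q. if w = v then 1 else 0)"
      unfolding g_def lookup_sum by (intro sum.cong refl) (auto simp: lookup_single when_def)
    then show ?thesis by simp
  qed
  have u_eq: "u = g + (u - g)"
    using Q(2) by (intro poly_mapping_eqI) (auto simp: lookup_add lookup_minus lg P_def Suc_le_eq)
  have "mon_degree g = 3"
    using Q(3) by (simp add: mon_degree_eq_sum lg)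
  then have g: "g \<in> bounded_mons 1 3" by (simp add: bounded_mons_def lg)
  have "mon_degree u = mon_degree g + mon_degree (u - g)" by (subst u_eq) (rule mon_degree_add)
  then have "mon_degree (u - g) = 3 * k"
    using \<open>mon_degree g = 3\<close> deg by (simp add: mon_degree_eq_sum)
  moreover have "Poly_Mapping.lookup (u - g) v \<le> k" for v
    using le[of v] Q(1) by (cases "v \<in> T") (auto simp: lookup_minus lg T_def)
  ultimately have "u - g \<in> bounded_mons k (3 * k)" by (simp add: bounded_mons_def)
  then show "u \<in> {g + h | g h. g \<in> bounded_mons 1 3 \<and> h \<in> bounded_mons k (3 * k)}"
    using g u_eq by blast
qed

lemma ideal_power_squarefree:
  fixes I :: "('v::finite, 'k::comm_ring_1) mpoly set"
  assumes I: "I = ideal_generated {monomial m | m. squarefree_mon m \<and> mon_degree m = 3}"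
  shows "ideal_power I k = mon_ideal (bounded_mons k (3 * k))"
proof (induction k)
  case 0
  have "0 \<in> (bounded_mons 0 0 :: 'v mon set)" by (simp add: bounded_mons_def mon_degree_def)
  then have "mon_ideal (bounded_mons 0 0) = (UNIV :: ('v, 'k) mpoly set)"
    by (auto simp: mon_ideal_def mon_dvd_def intro!: bexI[of _ 0])
  then show ?case by simp
next
  case (Suc k)
  have "{monomial m | m. squarefree_mon m \<and> mon_degree m = 3} = (monomial ` bounded_mons 1 3 :: ('v, 'k) mpoly set)"
    by (auto simp: squarefree_mon_def bounded_mons_def)
  then have "I = mon_ideal (bounded_mons 1 3)"
    unfolding I by (simp only: ideal_generated_monomials)
  then show ?case
    unfolding ideal_power.simps Suc bounded_mons_Suc by (simp only: mon_ideal_product)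
qed

section \<open>Binomial sums behind the matrix identity\<close>

lemma sum_alternating_choose_truncated:
  assumes "i < p"
  shows "(\<Sum>j<p. int (j choose i) * ((-1) ^ j * int (p choose j))) = - ((-1) ^ p * int (p choose i))"
proof -
  \<comment> \<open>Up to sign, the full sum is \<open>p choose i\<close> times the alternating sum
    of row \<open>p - i\<close>, which is zero as \<open>p - i > 0\<close>. The truncated sum misses
    only the term \<open>j = p\<close>.\<close>
  have "(\<Sum>j\<le>p. int (j choose i) * ((-1) ^ j * int (p choose j))) = 0"
  proof -
    have "(\<Sum>j\<le>p. int (j choose i) * ((-1) ^ j * int (p choose j))) =
        (\<Sum>j=i..p. int (j choose i) * ((-1) ^ j * int (p choose j)))"
      by (intro sum.mono_neutral_right) auto
    also have "\<dots> = (\<Sum>j=i..p. int (p choose i) * ((-1) ^ j * int ((p - i) choose (j - i))))"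
    proof (intro sum.cong refl)
      fix j assume "j \<in> {i..p}"
      then have "int (p choose j) * int (j choose i) = int (p choose i) * int ((p - i) choose (j - i))"
        using choose_mult[of i j p] unfolding of_nat_mult[symmetric] by simp
      then have "(-1) ^ j * (int (p choose j) * int (j choose i)) =
          (-1) ^ j * (int (p choose i) * int ((p - i) choose (j - i)))" by (rule arg_cong)
      then show "int (j choose i) * ((-1) ^ j * int (p choose j)) = int (p choose i) * ((-1) ^ j * int ((p - i) choose (j - i)))"
        by (simp only: ac_simps)
    qed
    also have "\<dots> = (\<Sum>l\<le>p - i. int (p choose i) * ((-1) ^ (l + i) * int ((p - i) choose l)))"
      using assms by (intro sum.reindex_bij_witness[of _ "\<lambda>l. l + i" "\<lambda>j. j - i"]) auto
    also have "\<dots> = int (p choose i) * (-1) ^ i * (\<Sum>l\<le>p - i. (-1) ^ l * int ((p - i) choose l))"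
      unfolding sum_distrib_left by (intro sum.cong refl) (simp only: power_add ac_simps)
    also have "\<dots> = 0" using choose_alternating_sum[of "p - i"] assms by simp
    finally show ?thesis .
  qed
  then have "(\<Sum>j<p. int (j choose i) * ((-1) ^ j * int (p choose j))) + int (p choose i) * ((-1) ^ p * 1) = 0"
    unfolding lessThan_Suc_atMost[symmetric] sum.lessThan_Suc binomial_n_n of_nat_1 .
  then show ?thesis by (simp only: eq_neg_iff_add_eq_0 mult_1_right mult.commute)
qed

text \<open>After exchanging the summations, the coefficient of \<open>N l\<close> is the sum of
  \<open>j choose i\<close> over \<open>l \<le> j < p\<close>, a difference of two hockey-stick
  sums.\<close>

lemma sum_choose_mult_partial_sums:
  "(\<Sum>j<p. int (j choose i) * (\<Sum>l\<le>j. N l)) =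
    (\<Sum>l<p. N l * (int (p choose Suc i) - int (l choose Suc i)))"
proof (induction p)
  case (Suc p)
  have "(\<Sum>l<Suc p. N l * (int (Suc p choose Suc i) - int (l choose Suc i))) =
     (\<Sum>l<p. N l * (int (p choose Suc i) - int (l choose Suc i))) + (\<Sum>l<p. N l * int (p choose i)) + N p * int (p choose i)"
    by (simp add: algebra_simps sum.distrib sum_subtractf)
  also have "\<dots> = (\<Sum>j<Suc p. int (j choose i) * (\<Sum>l\<le>j. N l))"
    unfolding Suc[symmetric] by (simp add: lessThan_Suc_atMost[symmetric] sum_distrib_left sum_distrib_right algebra_simps)
  finally show ?case ..
qed auto

text \<open>
  The subtracted binomial coefficient is the partial sum \<open>\<Sum>l\<le>j. N l\<close>, which turns the right-hand
  side into a linear expression in the numbers \<open>N l\<close>.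
\<close>

lemma betti_inversion:
  fixes N :: "nat \<Rightarrow> int"
  assumes N: "\<And>j. j < p \<Longrightarrow> N j = int ((c + j) choose j)" and i: "i < p"
  shows "(\<Sum>j<p + 2. N j * int (j choose Suc i)) =
    (\<Sum>j<p. int (j choose i) * ((\<Sum>l<p + 2. N l) - (-1) ^ (p + j) * N (p + 1) * int (p choose j)
       - int ((Suc c + j) choose j)))"
proof -
  have partial: "int ((Suc c + j) choose j) = (\<Sum>l\<le>j. N l)" if "j < p" for j
  proof -
    have "(\<Sum>l\<le>j. N l) = (\<Sum>l\<le>j. int ((c + l) choose l))" using that by (intro sum.cong refl N) auto
    also have "\<dots> = int ((Suc c + j) choose j)"
      using sum_choose_lower[of c j] by (simp flip: of_nat_sum)
    finally show ?thesis ..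
  qed
  have hockey: "(\<Sum>j<p. int (j choose i)) = int (p choose Suc i)"
    by (induction p) auto
  define S where "S = (\<Sum>l<p + 2. N l)"
  have "(\<Sum>j<p. int (j choose i) * (S - (-1) ^ (p + j) * N (p + 1) * int (p choose j)
       - int ((Suc c + j) choose j))) =
    (\<Sum>j<p. S * int (j choose i)
       - (-1) ^ p * N (p + 1) * (int (j choose i) * ((-1) ^ j * int (p choose j)))
       - int (j choose i) * (\<Sum>l\<le>j. N l))"
  proof (intro sum.cong refl)
    have alg: "x * (S - a * b * m * y - z) = S * x - a * m * (x * (b * y)) - x * z" for x y z a b m :: int
      by (simp only: right_diff_distrib ac_simps)
    fix j assume "j \<in> {..<p}"
    then have "j < p" by simp
    show "int (j choose i) * (S - (-1) ^ (p + j) * N (p + 1) * int (p choose j) - int ((Suc c + j) choose j)) =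
      S * int (j choose i) - (-1) ^ p * N (p + 1) * (int (j choose i) * ((-1) ^ j * int (p choose j)))
       - int (j choose i) * (\<Sum>l\<le>j. N l)"
      unfolding partial[OF \<open>j < p\<close>] power_add by (rule alg)
  qed
  also have "\<dots> = S * int (p choose Suc i)
       - (-1) ^ p * N (p + 1) * (\<Sum>j<p. int (j choose i) * ((-1) ^ j * int (p choose j)))
       - (\<Sum>j<p. int (j choose i) * (\<Sum>l\<le>j. N l))"
    by (simp only: sum_subtractf sum_distrib_left[symmetric] hockey)
  also have "\<dots> = S * int (p choose Suc i) + N (p + 1) * int (p choose i)
       - (\<Sum>l<p. N l) * int (p choose Suc i) + (\<Sum>l<p. N l * int (l choose Suc i))"
  proof -
    have "(-1) ^ p * m * - ((-1) ^ p * x) = - (m * x)" for m x :: int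
      by (cases "even p") auto
    then show ?thesis
      unfolding sum_alternating_choose_truncated[OF i] sum_choose_mult_partial_sums
      by (simp add: right_diff_distrib sum_subtractf sum_distrib_right)
  qed
  \<comment> \<open>Of \<open>S\<close> only \<open>N p\<close> and \<open>N (p + 1)\<close> survive
    the subtraction, and Pascal's rule merges the two coefficients of
    \<open>N (p + 1)\<close>.\<close>
  also have "\<dots> = (\<Sum>j<p + 2. N j * int (j choose Suc i))"
    unfolding S_def by (simp add: numeral_2_eq_2 algebra_simps)
  finally show ?thesis unfolding S_def ..
qed

theorem corollary2p5:
  fixes I :: "('v::finite, 'k::field) mpoly set"
    and n k :: nat
    and b :: "nat \<Rightarrow> int"
  assumes "n = CARD('v)"
    and "I = ideal_generated {monomial m | m. squarefree_mon m \<and> mon_degree m = 3}"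
    and "k \<ge> 1"
    and "\<And>i. b i = int (betti (ideal_power I k) i)"
  shows "b 1 = int ((n + 3 * k - 1) choose (n - 1))
                 - int n * int ((n + 2 * k - 2) choose (n - 1))
                 + int (n choose 2) * int ((n + k - 3) choose (n - 1))
       \<and> b n = int ((n + 3 * k - 2) choose (n - 1))
                 - int n * int ((n + 2 * k - 2) choose (n - 1))
                 + int (n choose 2) * int ((n + k - 2) choose (n - 1))
       \<and> vec (n - 2) (\<lambda>i. b (i + 2)) =
           mat (n - 2) (n - 2) (\<lambda>(i, j). int (j choose i)) *\<^sub>v
           vec (n - 2) (\<lambda>i. b 1 - (-1) ^ (n + i) * b n * int ((n - 2) choose i)
                               - int ((3 * k + i) choose i))"
proof -
  have n0: "0 < n" using assms(1) by simp
  have k0: "0 < k" using assms(3) by simp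
  obtain e :: "nat \<Rightarrow> 'v" where "bij_betw e {..<CARD('v)} UNIV"
    using ex_bij_betw_nat_finite[of "UNIV :: 'v set"] by (auto simp: atLeast0LessThan)
  then interpret variable_order e by unfold_locales
  have num_lists: "num_lists n (int m) = int ((m + n - 1) choose (n - 1))" for m
    using n0 by (simp add: num_lists_def)
  let ?N = "\<lambda>j. int (num_free k n (3 * k) j)"
  have b: "b i = (\<Sum>j<n. ?N j * int (j choose (i - 1)))" if "0 < i" for i
    using that k0 unfolding assms(4) ideal_power_squarefree[OF assms(2)] assms(1)
    by (simp add: betti_bounded_mons)
  have b1: "b 1 = (\<Sum>j<n. ?N j)" using b[of 1] by simp
  have free_less: "card (free_positions k xs) < n" if "xs \<in> bounded_lists (Suc k) n (3 * k)" for xs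
    using card_free_positions_less[of xs k] that k0
    by (simp add: bounded_lists_iff del: bounded_lists.simps)
  have "(\<Sum>j<n. num_free k n (3 * k) j) = card (bounded_lists (Suc k) n (3 * k))"
  proof -
    have "(\<Sum>j<n. num_free k n (3 * k) j) =
        (\<Sum>j<n. \<Sum>xs | xs \<in> bounded_lists (Suc k) n (3 * k) \<and> card (free_positions k xs) = j. 1)"
      by (simp add: num_free_def)
    also have "\<dots> = (\<Sum>xs\<in>bounded_lists (Suc k) n (3 * k). 1)"
      using free_less finite_bounded_lists[of "Suc k" n "3 * k"] by (intro sum.group) auto
    finally show ?thesis by simp
  qed
  then have b1': "b 1 = int (card (bounded_lists (Suc k) n (3 * k)))"
    unfolding b1 by (simp flip: of_nat_sum)
  have "b 1 = int ((n + 3 * k - 1) choose (n - 1)) - int n * int ((n + 2 * k - 2) choose (n - 1))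
      + int (n choose 2) * int ((n + k - 3) choose (n - 1))"
  proof -
    \<comment> \<open>Exponents at most \<open>k\<close> mean the strict bound
      \<open>q = Suc k\<close>, and \<open>3 * k < 3 * q\<close>.\<close>
    have "b 1 = num_lists n (int (3 * k)) - int n * num_lists n (int (3 * k) - int (Suc k))
       + int (n choose 2) * num_lists n (int (3 * k) - 2 * int (Suc k))"
      unfolding b1' by (rule card_bounded_lists) simp
    also have "num_lists n (int (3 * k)) = int ((n + 3 * k - 1) choose (n - 1))"
      unfolding num_lists by (simp only: add.commute)
    also have "num_lists n (int (3 * k) - int (Suc k)) = int ((n + 2 * k - 2) choose (n - 1))"
    proof -
      have "int (3 * k) - int (Suc k) = int (2 * k - 1)" using k0 by simp
      moreover have "2 * k - 1 + n - 1 = n + 2 * k - 2" using k0 by simp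
      ultimately show ?thesis by (simp only: num_lists)
    qed
    \<comment> \<open>Truncated subtraction matters here. For \<open>n = 1\<close> the factor
      \<open>n choose 2\<close> is 0; for \<open>k = 1\<close> and \<open>n \<ge> 2\<close> the sum
      is negative on the left, while on the right \<open>n - 2 < n - 1\<close> makes the binomial
      coefficient vanish.\<close>
    also have "int (n choose 2) * num_lists n (int (3 * k) - 2 * int (Suc k)) =
        int (n choose 2) * int ((n + k - 3) choose (n - 1))"
    proof (cases "n < 2")
      case False
      show ?thesis
      proof (cases "k = 1")
        case True
        then show ?thesis using False by (simp add: num_lists_def)
      next
        case k1: False
        have "int (3 * k) - 2 * int (Suc k) = int (k - 2)" using k0 k1 by simp
        moreover have "k - 2 + n - 1 = n + k - 3" using k0 k1 by simp
        ultimately show ?thesis by (simp only: num_lists)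
      qed
    qed (simp add: binomial_eq_0)
    finally show ?thesis .
  qed
  moreover have bn: "b n = ?N (n - 1)"
  proof -
    have "b n = (\<Sum>j<Suc (n - 1). ?N j * int (j choose (n - 1)))" using b[OF n0] n0 by simp
    also have "\<dots> = ?N (n - 1)" unfolding sum.lessThan_Suc by (simp add: binomial_eq_0)
    finally show ?thesis .
  qed
  moreover have "?N (n - 1) = int ((n + 3 * k - 2) choose (n - 1)) - int n * int ((n + 2 * k - 2) choose (n - 1))
      + int (n choose 2) * int ((n + k - 2) choose (n - 1))"
  proof -
    \<comment> \<open>The strict bound is now \<open>k\<close> and the sum is
      \<open>3 * k - 1\<close>, just inside the range where inclusion-exclusion stops at
      pairs.\<close>
    have "?N (n - 1) = int (card (bounded_lists k n (3 * k - 1)))"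
      using num_free_top[of "3 * k" k "n - 1"] n0 k0 by (simp del: bounded_lists.simps)
    also have "\<dots> = num_lists n (int (3 * k - 1)) - int n * num_lists n (int (3 * k - 1) - int k)
       + int (n choose 2) * num_lists n (int (3 * k - 1) - 2 * int k)"
      using k0 by (intro card_bounded_lists) simp
    also have "int (3 * k - 1) - int k = int (2 * k - 1)" using k0 by simp
    also have "int (3 * k - 1) - 2 * int k = int (k - 1)" using k0 by simp
    also note num_lists
    also note num_lists
    also note num_lists
    also have "3 * k - 1 + n - 1 = n + 3 * k - 2" using k0 by simp
    also have "2 * k - 1 + n - 1 = n + 2 * k - 2" using k0 by simp
    also have "k - 1 + n - 1 = n + k - 2" using k0 by simp
    finally show ?thesis .
  qed
  moreover have "vec (n - 2) (\<lambda>i. b (i + 2)) =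
           mat (n - 2) (n - 2) (\<lambda>(i, j). int (j choose i)) *\<^sub>v
           vec (n - 2) (\<lambda>i. b 1 - (-1) ^ (n + i) * b n * int ((n - 2) choose i)
                               - int ((3 * k + i) choose i))"
  proof (rule eq_vecI)
    fix i assume "i < dim_vec (mat (n - 2) (n - 2) (\<lambda>(i, j). int (j choose i)) *\<^sub>v
           vec (n - 2) (\<lambda>i. b 1 - (-1) ^ (n + i) * b n * int ((n - 2) choose i)
                               - int ((3 * k + i) choose i)))"
    then have i: "i < n - 2" by simp
    then have n2: "n - 2 + 2 = n" "n - 2 + 1 = n - 1" by simp_all
    have sign: "(-1) ^ (n - 2 + j) = (-1 :: int) ^ (n + j)" for j
    proof -
      have "n + j = n - 2 + j + 2" using i by simp
      then have "(-1 :: int) ^ (n + j) = (-1) ^ (n - 2 + j) * (-1) ^ 2" by (simp only: power_add)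
      then show ?thesis by simp
    qed
    have c: "Suc (3 * k - 1) = 3 * k" using k0 by simp
    have "?N j = int ((3 * k - 1 + j) choose j)" if "j < n - 2" for j
    proof -
      \<comment> \<open>This quotient is why the closed form of \<open>?N j\<close> is available
        precisely for the indices \<open>j < n - 2\<close> of the matrix.\<close>
      have "(3 * k - 1) div k = 2" using k0 by (intro div_nat_eqI) auto
      then show ?thesis using that k0 by (subst num_free_eq) auto
    qed
    \<comment> \<open>For \<open>p = n - 2\<close> the sum of all \<open>?N l\<close> is
      \<open>b 1\<close> and the last term \<open>?N (p + 1)\<close> is \<open>b n\<close>, so both
      become Betti numbers; \<open>c = 3 * k - 1\<close> gives the binomials with
      \<open>3 * k\<close>.\<close>
    from betti_inversion[of "n - 2" ?N "3 * k - 1", OF this i, unfolded n2 c]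
    have "b (i + 2) = (\<Sum>j<n - 2. int (j choose i) * (b 1 - (-1) ^ (n + j) * b n * int ((n - 2) choose j)
       - int ((3 * k + j) choose j)))"
      using b[of "i + 2"] unfolding b1 bn sign by simp
    then show "vec (n - 2) (\<lambda>i. b (i + 2)) $ i = (mat (n - 2) (n - 2) (\<lambda>(i, j). int (j choose i)) *\<^sub>v
           vec (n - 2) (\<lambda>i. b 1 - (-1) ^ (n + i) * b n * int ((n - 2) choose i)
                               - int ((3 * k + i) choose i))) $ i"
      using i by (simp add: scalar_prod_def atLeast0LessThan)
  qed simp
  ultimately show ?thesis by simp
qed

end
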